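(* Let $1<p,r<\infty$ and let $r'=\frac{r}{r-1}$. There is a constant $C$, depending only on $n,p,r$, such that for every $\kappa\in\mathbb{N}$ and every positive vector-valued Haar-shift operator $\mathcal{P}_r$ on $\mathbb{R}^n$ with parameter $\kappa$, $$\|\mathcal{P}_r\|_{L^p_{\ell^r}\to L^p}\le C\,\kappa^2\,\kappa^{\max\{r,r'\}},$$ the norms being taken with respect to Lebesgue measure.
   Context: $\mathbb{N}=\{1,2,\dots\}$. For $u\in\{0,1/3\}^n$, $\mathcal{D}^u=\{2^{-k}([0,1)^n+m+(-1)^ku):k\in\mathbb{Z},m\in\mathbb{Z}^n\}$; these are the dyadic systems. A collection of dyadic cubes $\mathcal{Q}=\{Q^k_j\}$ (all from one dyadic system) is called sparse if (i) for each fixed $k$, the cubes $Q^k_j$ are pairwise disjoint in $j$; (ii) for each $Q\in\mathcal{Q}$, the set $D(Q)=Q\setminus\bigcup_{Q'\in\mathcal{Q},\,Q'\subsetneq Q}Q'$ satisfies $|D(Q)|\ge 2^{-1}|Q|$. A positive vector-valued Haar-shift operator $\mathcal{P}_r$ with parameter $\kappa$ is defined as follows. For each $j\ge1$ let $\mathcal{Q}_j$ be a sparse collection of dyadic cubes, all the $\mathcal{Q}_j$ being from the same dyadic system, and for each $Q\in\mathcal{Q}_j$ let $E_j(Q)$ be a union of subcubes of $Q$ with $2^{-\kappa}|Q|\le|E_j(Q)|$. Put $P^j(f)(x)=\sum_{Q\in\mathcal{Q}_j}\mathbb{E}_Q(f)\mathbf{1}_{E_j(Q)}(x)$, where $\mathbb{E}_Q(f)=\frac1{|Q|}\int_Qf\,dx$,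 and for $\mathbf{f}=\{f_j\}_{j\ge1}$ $$\mathcal{P}_r(\mathbf{f})(x)=\Big(\sum_{j=1}^\infty|P^jf_j(x)|^r\Big)^{1/r}.$$ $L^p_{\ell^r}$ is the space of sequences $\mathbf{f}=\{f_j\}$ of measurable functions on $\mathbb{R}^n$ with $\|\mathbf{f}\|_{L^p_{\ell^r}}=\big(\int_{\mathbb{R}^n}(\sum_j|f_j(x)|^r)^{p/r}dx\big)^{1/p}<\infty$, and $\|\mathcal{P}_r\|_{L^p_{\ell^r}\to L^p}$ is the least $A$ with $\|\mathcal{P}_r(\mathbf{f})\|_{L^p}\le A\|\mathbf{f}\|_{L^p_{\ell^r}}$ for all $\mathbf{f}\in L^p_{\ell^r}$. *)

theory Defs
  imports "HOL-Analysis.Analysis"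
begin

section \<open>Dyadic systems and sparse collections\<close>

definition shift_params :: "(real ^ 'n::finite) set" where
  "shift_params = {u. \<forall>i. u $ i \<in> {0, 1/3}}"

definition unit_cube :: "(real ^ 'n::finite) set" where
  "unit_cube = {x. \<forall>i. 0 \<le> x $ i \<and> x $ i < 1}"

definition dyadic_system :: "real ^ 'n::finite \<Rightarrow> (real ^ 'n) set set" where
  "dyadic_system u =
     {(\<lambda>x. (2 powi (- k)) *\<^sub>R (x + (\<chi> i. of_int (m i)) + ((- 1) powi k) *\<^sub>R u)) ` unit_cube
       | (k :: int) (m :: 'n \<Rightarrow> int). True}"

definition is_cube :: "(real ^ 'n::finite) set \<Rightarrow> bool" where
  "is_cube Q \<longleftrightarrow> (\<exists>a l. 0 < l \<and> Q = (\<lambda>x. a + l *\<^sub>R x) ` unit_cube)"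

definition sparse_kernel :: "(real ^ 'n::finite) set set \<Rightarrow> (real ^ 'n) set \<Rightarrow> (real ^ 'n) set" where
  "sparse_kernel \<Q> Q = Q - \<Union>{Q' \<in> \<Q>. Q' \<subset> Q}"

text \<open>
  A collection \<open>{Q\<^sup>k\<^sub>j}\<close> is represented by its set of cubes; \<open>gen Q\<close> is the upper index \<open>k\<close> of \<open>Q\<close>,
  so that the cubes \<open>Q\<^sup>k\<^sub>j\<close> for fixed \<open>k\<close> are those with \<open>gen Q = k\<close>.
\<close>

definition sparse :: "real ^ 'n::finite \<Rightarrow> (real ^ 'n) set set \<Rightarrow> bool" where
  "sparse u \<Q> \<longleftrightarrow>
     \<Q> \<subseteq> dyadic_system u \<and>
     (\<exists>gen :: (real ^ 'n) set \<Rightarrow> int. \<forall>k. disjoint {Q \<in> \<Q>. gen Q = k}) \<and>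
     (\<forall>Q\<in>\<Q>. measure lebesgue (sparse_kernel \<Q> Q) \<ge> (1/2) * measure lebesgue Q)"

section \<open>Positive vector-valued Haar shifts\<close>

text \<open>
  A shift is given by the collections \<open>\<Q> j\<close> and the sets \<open>E j Q\<close>; the values of \<open>E j\<close> outside
  \<open>\<Q> j\<close> are irrelevant. Sequences are indexed by \<open>j = 0, 1, 2, \<dots>\<close> instead of \<open>j \<ge> 1\<close>.
\<close>

definition positive_haar_shift ::
    "nat \<Rightarrow> (nat \<Rightarrow> (real ^ 'n::finite) set set) \<Rightarrow> (nat \<Rightarrow> (real ^ 'n) set \<Rightarrow> (real ^ 'n) set) \<Rightarrow> bool" where
  "positive_haar_shift \<kappa> \<Q> E \<longleftrightarrow>
     (\<exists>u\<in>shift_params. \<forall>j. sparse u (\<Q> j)) \<and>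
     (\<forall>j. \<forall>Q\<in>\<Q> j.
        (\<exists>\<C>. (\<forall>K\<in>\<C>. is_cube K \<and> K \<subseteq> Q) \<and> E j Q = \<Union>\<C>) \<and>
        measure lebesgue Q / 2 ^ \<kappa> \<le> measure lebesgue (E j Q))"

definition cube_average :: "(real ^ 'n::finite) set \<Rightarrow> (real ^ 'n \<Rightarrow> complex) \<Rightarrow> complex" where
  "cube_average Q f = (1 / measure lebesgue Q) *\<^sub>R (LINT x:Q|lebesgue. f x)"

text \<open>
  For functions with finite mixed norm the sum below converges absolutely for almost every
  \<open>x\<close>; where it does not, \<open>infsum\<close> takes the value \<open>0\<close>, which affects only a null set.
\<close>

definition scalar_shift ::
    "(real ^ 'n::finite) set set \<Rightarrow> ((real ^ 'n) set \<Rightarrow> (real ^ 'n) set) \<Rightarrow>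
     (real ^ 'n \<Rightarrow> complex) \<Rightarrow> real ^ 'n \<Rightarrow> complex" where
  "scalar_shift \<Q> E f x = (\<Sum>\<^sub>\<infinity>Q\<in>\<Q>. indicator (E Q) x *\<^sub>R cube_average Q f)"

text \<open>Powers of extended nonnegative reals, used only with positive exponents.\<close>

definition enn_powr :: "ennreal \<Rightarrow> real \<Rightarrow> ennreal" where
  "enn_powr x a = (if x = \<infinity> then \<infinity> else ennreal (enn2real x powr a))"

definition vector_shift ::
    "real \<Rightarrow> (nat \<Rightarrow> (real ^ 'n::finite) set set) \<Rightarrow> (nat \<Rightarrow> (real ^ 'n) set \<Rightarrow> (real ^ 'n) set) \<Rightarrow>
     (nat \<Rightarrow> real ^ 'n \<Rightarrow> complex) \<Rightarrow> real ^ 'n \<Rightarrow> ennreal" where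
  "vector_shift r \<Q> E f x =
     enn_powr (\<Sum>j. ennreal (norm (scalar_shift (\<Q> j) (E j) (f j) x) powr r)) (1 / r)"

section \<open>Norms\<close>

definition Lp_norm :: "real \<Rightarrow> (real ^ 'n::finite \<Rightarrow> ennreal) \<Rightarrow> ennreal" where
  "Lp_norm p g = enn_powr (\<integral>\<^sup>+x. enn_powr (g x) p \<partial>lebesgue) (1 / p)"

definition Lp_ellr_norm :: "real \<Rightarrow> real \<Rightarrow> (nat \<Rightarrow> real ^ 'n::finite \<Rightarrow> complex) \<Rightarrow> ennreal" where
  "Lp_ellr_norm p r f =
     enn_powr (\<integral>\<^sup>+x. enn_powr (\<Sum>j. ennreal (norm (f j x) powr r)) (p / r) \<partial>lebesgue) (1 / p)"

definition Lp_ellr :: "real \<Rightarrow> real \<Rightarrow> (nat \<Rightarrow> real ^ 'n::finite \<Rightarrow> complex) set" where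
  "Lp_ellr p r = {f. (\<forall>j. f j \<in> borel_measurable lebesgue) \<and> Lp_ellr_norm p r f < \<infinity>}"

definition shift_norm ::
    "real \<Rightarrow> real \<Rightarrow> (nat \<Rightarrow> (real ^ 'n::finite) set set) \<Rightarrow>
     (nat \<Rightarrow> (real ^ 'n) set \<Rightarrow> (real ^ 'n) set) \<Rightarrow> ennreal" where
  "shift_norm p r \<Q> E =
     Inf {A. \<forall>f\<in>Lp_ellr p r. Lp_norm p (vector_shift r \<Q> E f) \<le> A * Lp_ellr_norm p r f}"

end

theory Submission
  imports Defs
begin

text \<open>
  The sets \<open>E j Q\<close> lie in \<open>Q\<close> and all operators are positive, so the shift is dominated by the sparse
  operators \<open>S\<^sub>j f = \<Sum>\<^sub>Q \<langle>|f|\<rangle>\<^sub>Q 1\<^sub>Q\<close>, the sum being over \<open>\<Q> j\<close>. These are bounded from the mixed norm space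
  to \<open>L\<^sup>p\<close> with a constant depending on \<open>p\<close> and \<open>r\<close> only (\<open>sparse_vector_bound\<close>), and \<open>\<kappa> \<ge> 1\<close> makes the powers of
  \<open>\<kappa>\<close> in the claim at least one.

  To bound the sparse operators, pair \<open>S\<^sub>j f\<^sub>j\<close> with a dual sequence \<open>g\<^sub>j\<close>. The pairing is a sum of
  \<open>\<langle>f\<^sub>j\<rangle>\<^sub>Q \<langle>g\<^sub>j\<rangle>\<^sub>Q |Q|\<close>, and sparsity lets \<open>|Q|\<close> be replaced by twice the measure of the disjoint sets
  \<open>sparse_kernel (\<Q> j) Q\<close>, so that the pairing is at most \<open>2 \<integral> \<Sum>\<^sub>j M f\<^sub>j M g\<^sub>j\<close> with the dyadic maximal
  operator \<open>M\<close> (\<open>sparse_form_le_maximal\<close>). Hoelder's inequality then leaves the vector-valued maximal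
  inequality of Fefferman and Stein, for \<open>(p, r)\<close> and for the conjugate exponents
  (\<open>vector_maximal_bound\<close>).

  That inequality rests on the scalar weighted one, \<open>\<integral> (M g)\<^sup>q w \<le> C \<integral> g\<^sup>q M w\<close>
  (\<open>maximal_weighted_bound\<close>), which follows from a weak type estimate on the maximal cubes of a level
  set. For \<open>p > r\<close> one dualises with a weight. For \<open>p < r\<close> the splitting
  \<open>f\<^sub>j = \<phi>\<^sub>j\<^bsup>p/r\<^esup> N\<^bsup>1-p/r\<^esup>\<close> through the pointwise norm \<open>N\<close> reduces the claim to the scalar case \<open>w = 1\<close>.

  All estimates are made for finite families of sets that are pairwise nested or disjoint, in an
  arbitrary sigma-finite measure space; monotone convergence passes to the full countable
  collections.
\<close>

section \<open>Powers of extended nonnegative reals and Hoelder's inequality\<close>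

lemma enn_powr_ennreal: "0 \<le> x \<Longrightarrow> enn_powr (ennreal x) a = ennreal (x powr a)"
  by (simp add: enn_powr_def)

lemma enn_powr_top [simp]: "enn_powr top a = top"
  by (simp add: enn_powr_def)

lemma enn_powr_0 [simp]: "enn_powr 0 a = 0"
  by (simp add: enn_powr_def)

lemma enn_powr_1_left [simp]: "enn_powr 1 a = 1"
  by (simp add: enn_powr_def)

lemma enn_powr_1_right [simp]: "enn_powr x 1 = x"
  by (cases x) (auto simp: enn_powr_def)

lemma enn_powr_eq_0_iff [simp]: "enn_powr x a = 0 \<longleftrightarrow> x = 0"
  by (cases x) (auto simp: enn_powr_def)

lemma enn_powr_eq_top_iff [simp]: "enn_powr x a = top \<longleftrightarrow> x = top"
  by (cases x) (auto simp: enn_powr_def)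

lemma enn_powr_powr: "enn_powr (enn_powr x a) b = enn_powr x (a * b)"
  by (cases x) (auto simp: enn_powr_def powr_powr)

lemma enn_powr_add: "enn_powr x (a + b) = enn_powr x a * enn_powr x b"
  by (cases x) (auto simp: enn_powr_def powr_add ennreal_mult ennreal_mult_top)

lemma enn_powr_mult: "enn_powr (x * y) a = enn_powr x a * enn_powr y a"
  by (cases x; cases y; cases "x = 0"; cases "y = 0")
    (auto simp: enn_powr_def powr_mult ennreal_mult[symmetric] ennreal_mult_top ennreal_top_mult)

lemma enn_powr_mono:
  assumes "x \<le> y" "0 < a"
  shows "enn_powr x a \<le> enn_powr y a"
  using assms by (cases x; cases y) (auto simp: enn_powr_def powr_mono2 top_unique)

text \<open>
  The power with positive exponent is an order automorphism, with the power of reciprocal exponent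
  as its inverse; hence it commutes with suprema.
\<close>

lemma enn_powr_SUP:
  assumes "0 < a"
  shows "enn_powr (SUP i\<in>I. x i) a = (SUP i\<in>I. enn_powr (x i) a)"
proof (rule antisym)
  let ?S = "SUP i\<in>I. enn_powr (x i) a"
  have "x i \<le> enn_powr ?S (1 / a)" if "i \<in> I" for i
    using enn_powr_mono[OF SUP_upper[OF that, of "\<lambda>i. enn_powr (x i) a"], of "1 / a"] assms
    by (simp add: enn_powr_powr)
  then have "enn_powr (SUP i\<in>I. x i) a \<le> enn_powr (enn_powr ?S (1 / a)) a"
    using assms by (intro enn_powr_mono SUP_least)
  then show "enn_powr (SUP i\<in>I. x i) a \<le> ?S" using assms by (simp add: enn_powr_powr)
  show "?S \<le> enn_powr (SUP i\<in>I. x i) a"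
    using assms by (intro SUP_least enn_powr_mono SUP_upper)
qed

lemma measurable_enn_powr [measurable]:
  assumes [measurable]: "f \<in> borel_measurable M"
  shows "(\<lambda>x. enn_powr (f x) a) \<in> borel_measurable M"
  unfolding enn_powr_def by measurable

lemma le_1_plus_enn_powr:
  assumes "1 \<le> p"
  shows "x \<le> 1 + enn_powr x p"
proof (cases x)
  case (real a)
  have "a \<le> 1 + a powr p"
  proof (cases "a \<le> 1")
    case False
    then have "a powr 1 \<le> a powr p" using assms by (intro powr_mono) auto
    then show ?thesis using False by auto
  qed (use powr_ge_zero[of a p] in linarith)
  then show ?thesis using real by (simp add: enn_powr_ennreal flip: ennreal_1 ennreal_plus)
qed simp

text \<open>
  The closing step of both duality arguments: a self-bound with exponent below one on the right
  is resolved by cancelling, which is legitimate because \<open>x\<close> is finite.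
\<close>

lemma enn_powr_absorb:
  assumes "x \<le> K * enn_powr x b" "x \<noteq> top" "a + b = 1" "0 < a" 
  shows "x \<le> enn_powr K (1 / a)"
proof (cases "x = 0")
  case False
  have "enn_powr x a * enn_powr x b \<le> K * enn_powr x b"
    using assms by (simp flip: enn_powr_add)
  then have "enn_powr x a \<le> K"
    using False assms(2) by (subst (asm) (1 2) mult.commute) (simp add: ennreal_mult_le_mult_iff)
  then have "enn_powr (enn_powr x a) (1/a) \<le> enn_powr K (1/a)"
    using assms(4) by (intro enn_powr_mono) auto
  then show ?thesis using assms(4) by (simp add: enn_powr_powr)
qed simp

lemma enn_Young:
  assumes "0 < a" "0 < b" "a + b = (1::real)"
  shows "enn_powr x a * enn_powr y b \<le> ennreal a * x + ennreal b * y"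
proof -
  consider "x = 0 \<or> y = 0" | "x = top \<or> y = top"
    | s t where "x = ennreal s" "y = ennreal t" "0 < s" "0 < t"
    by (cases x; cases y) (auto simp: less_le)
  then show ?thesis
  proof cases
    case 3
    then show ?thesis
      using Youngs_inequality_0[of a b s t] assms
      by (simp add: enn_powr_ennreal ennreal_mult[symmetric] ennreal_plus[symmetric] del: ennreal_plus)
  qed (use assms in \<open>auto simp: ennreal_mult_top\<close>)
qed

text \<open>
  Hoelder's inequality for \<open>u\<^sup>a\<close> and \<open>v\<^sup>b\<close>, a form with positive exponents only. After both integrals
  are normalised to one it is Young's inequality pointwise; a vanishing integral forces the product
  to vanish almost everywhere.
\<close>

lemma nn_integral_Hoelder:
  assumes [measurable]: "u \<in> borel_measurable M" "v \<in> borel_measurable M"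
    and ab: "0 < a" "0 < b" "a + b = (1::real)"
  shows "(\<integral>\<^sup>+x. enn_powr (u x) a * enn_powr (v x) b \<partial>M)
           \<le> enn_powr (\<integral>\<^sup>+x. u x \<partial>M) a * enn_powr (\<integral>\<^sup>+x. v x \<partial>M) b"
    (is "?L \<le> enn_powr ?U a * enn_powr ?V b")
proof -
  have zero: "?L = 0" if "?U = 0 \<or> ?V = 0"
  proof -
    have "AE x in M. u x = 0 \<or> v x = 0"
      using that by (auto simp: nn_integral_0_iff_AE elim: AE_mp)
    then show ?thesis by (subst nn_integral_0_iff_AE) auto
  qed
  consider "?U = 0 \<or> ?V = 0" | "?U = top" "?V \<noteq> 0" | "?V = top" "?U \<noteq> 0"
    | "?U \<noteq> 0" "?V \<noteq> 0" "?U \<noteq> top" "?V \<noteq> top" by blast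
  then show ?thesis
  proof cases
    case 4
    let ?K = "enn_powr ?U a * enn_powr ?V b"
    have cancel: "?U * inverse ?U = 1" "?V * inverse ?V = 1"
      using 4 by (simp_all add: divide_ennreal_def[symmetric] ennreal_divide_self less_top)
    have inv: "enn_powr ?U a * enn_powr (inverse ?U) a = 1" "enn_powr ?V b * enn_powr (inverse ?V) b = 1"
      by (simp_all add: cancel flip: enn_powr_mult)
    have "?L = (\<integral>\<^sup>+x. ?K * (enn_powr (u x * inverse ?U) a * enn_powr (v x * inverse ?V) b) \<partial>M)"
    proof (rule nn_integral_cong)
      fix x
      have "?K * (enn_powr (u x * inverse ?U) a * enn_powr (v x * inverse ?V) b)
          = enn_powr (u x) a * enn_powr (v x) b * (enn_powr ?U a * enn_powr (inverse ?U) a)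
              * (enn_powr ?V b * enn_powr (inverse ?V) b)"
        by (simp add: enn_powr_mult mult_ac)
      then show "enn_powr (u x) a * enn_powr (v x) b
          = ?K * (enn_powr (u x * inverse ?U) a * enn_powr (v x * inverse ?V) b)"
        by (simp add: inv)
    qed
    also have "\<dots> \<le> (\<integral>\<^sup>+x. ?K * (ennreal a * (u x * inverse ?U) + ennreal b * (v x * inverse ?V)) \<partial>M)"
      by (intro nn_integral_mono mult_left_mono enn_Young ab) auto
    also have "\<dots> = ?K * (ennreal a * (?U * inverse ?U) + ennreal b * (?V * inverse ?V))"
      by (simp add: nn_integral_cmult nn_integral_add nn_integral_multc)
    finally show ?thesis using ab by (simp add: cancel flip: ennreal_plus)
  qed (use zero in \<open>auto simp: ennreal_mult_top ennreal_top_mult\<close>)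
qed

lemma sum_Hoelder:
  assumes "finite J" and ab: "0 < a" "0 < b" "a + b = (1::real)"
  shows "(\<Sum>j\<in>J. enn_powr (u j) a * enn_powr (v j) b)
           \<le> enn_powr (\<Sum>j\<in>J. u j) a * enn_powr (\<Sum>j\<in>J. v j) b"
  using nn_integral_Hoelder[of u "count_space J" v a b] assms
  by (simp add: nn_integral_count_space_finite)

text \<open>
  For \<open>s < 1\<close> the integrand is singular at \<open>0\<close>. An infinite \<open>a\<close> has to be included because maximal
  functions may take the value infinity; that case follows from arbitrarily large finite ones.
\<close>

lemma layer_cake:
  assumes s: "0 < s"
  shows "(\<integral>\<^sup>+t. ennreal (t powr (s - 1)) * indicator {t. 0 < t \<and> ennreal t < a} t \<partial>lborel)
           = enn_powr a s / ennreal s"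
proof -
  let ?I = "\<lambda>a. \<integral>\<^sup>+t. ennreal (t powr (s - 1)) * indicator {t. 0 < t \<and> ennreal t < a} t \<partial>lborel"
  have fin: "?I (ennreal c) = ennreal (c powr s) / ennreal s" if "0 \<le> c" for c
  proof -
    have "((\<lambda>t. t powr (s - 1)) has_integral (c powr s / s)) {0..c}"
      using has_integral_powr_from_0[of "s - 1" c] s that by simp
    then have "(\<integral>\<^sup>+t. ennreal (t powr (s - 1)) * indicator {0..c} t \<partial>lborel) = ennreal (c powr s / s)"
      by (intro nn_integral_has_integral_lebesgue') auto
    also have "(\<integral>\<^sup>+t. ennreal (t powr (s - 1)) * indicator {0..c} t \<partial>lborel) = ?I (ennreal c)"
    proof (rule nn_integral_cong_AE)
      have "AE t in lborel. t \<noteq> c" by (rule AE_lborel_singleton)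
      then show "AE t in lborel. ennreal (t powr (s - 1)) * indicator {0..c} t =
          ennreal (t powr (s - 1)) * indicator {t. 0 < t \<and> ennreal t < ennreal c} t"
        by eventually_elim (auto split: split_indicator simp: ennreal_less_iff)
    qed
    finally show ?thesis using s by (simp add: divide_ennreal)
  qed
  show ?thesis
  proof (cases a)
    case (real c)
    then show ?thesis using fin by (simp add: enn_powr_ennreal)
  next
    case top
    have "?I top \<ge> ennreal C" if "0 < C" for C
    proof -
      have "ennreal C = ?I (ennreal ((C * s) powr (1 / s)))"
        using that s by (simp add: fin powr_powr divide_ennreal)
      also have "\<dots> \<le> ?I top"
        by (intro nn_integral_mono mult_left_mono) (auto split: split_indicator simp: less_top)
      finally show ?thesis .
    qed
    then have ge: "ennreal C \<le> ?I top" if "0 < C" for C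
      using that by blast
    have "?I top = top"
    proof (cases "?I top")
      case (real c)
      then have "ennreal (c + 1) \<le> ennreal c" using ge[of "c + 1"] by simp
      then show ?thesis using real by (simp del: ennreal_plus)
    qed
    then show ?thesis using top s by (simp add: ennreal_top_divide)
  qed
qed

section \<open>The maximal operator of a finite laminar family\<close>

definition average :: "'a measure \<Rightarrow> 'a set \<Rightarrow> ('a \<Rightarrow> ennreal) \<Rightarrow> ennreal" where
  "average M Q f = (\<integral>\<^sup>+x\<in>Q. f x \<partial>M) / emeasure M Q"

text \<open>
  The constant of the maximal inequality on \<open>L\<^sup>q\<close>, as it comes out of integrating the weak type
  estimate over all levels.
\<close>

definition maximal_const :: "real \<Rightarrow> ennreal" where
  "maximal_const q = ennreal (2 powr q * q / (q - 1))"

lemma maximal_const_pos: "1 < q \<Longrightarrow> maximal_const q \<noteq> 0"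
  by (simp add: maximal_const_def ennreal_eq_0_iff not_le)

text \<open>
  Two cubes of one dyadic system are disjoint or nested, which is the property behind the
  maximal inequalities. Restricting to finitely many sets makes maximal elements available; the
  general case is recovered at the end by monotone convergence.
\<close>

locale laminar_family = sigma_finite_measure M for M :: "'a measure" +
  fixes F :: "'a set set"
  assumes finite_F: "finite F"
    and sets_F [measurable]: "Q \<in> F \<Longrightarrow> Q \<in> sets M"
    and emeasure_F: "Q \<in> F \<Longrightarrow> emeasure M Q \<noteq> 0" "Q \<in> F \<Longrightarrow> emeasure M Q \<noteq> top"
    and laminar: "P \<in> F \<Longrightarrow> Q \<in> F \<Longrightarrow> P \<inter> Q = {} \<or> P \<subseteq> Q \<or> Q \<subseteq> P"
begin

definition maximal :: "('a \<Rightarrow> ennreal) \<Rightarrow> 'a \<Rightarrow> ennreal" where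
  "maximal f x = (SUP Q\<in>F. average M Q f * indicator Q x)"

lemma measurable_maximal [measurable]: "maximal f \<in> borel_measurable M"
proof -
  have "(\<lambda>x. SUP Q\<in>F. average M Q f * indicator Q x) \<in> borel_measurable M"
    using finite_F by (intro borel_measurable_SUP) (auto intro: countable_finite sets_F)
  then show ?thesis by (simp add: maximal_def[abs_def])
qed

lemma average_le_maximal: "Q \<in> F \<Longrightarrow> x \<in> Q \<Longrightarrow> average M Q f \<le> maximal f x"
  unfolding maximal_def by (rule SUP_upper2[of Q]) auto

lemma maximal_le:
  assumes "\<And>Q. Q \<in> F \<Longrightarrow> x \<in> Q \<Longrightarrow> average M Q f \<le> c"
  shows "maximal f x \<le> c"
  unfolding maximal_def using assms by (intro SUP_least) (auto split: split_indicator)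

lemma average_times_emeasure: "Q \<in> F \<Longrightarrow> average M Q f * emeasure M Q = (\<integral>\<^sup>+x\<in>Q. f x \<partial>M)"
  unfolding average_def using emeasure_F[of Q]
  by (simp add: ennreal_divide_times less_top)

text \<open>
  On a set where the average of \<open>g\<close> exceeds \<open>t\<close>, the part of \<open>g\<close> below \<open>t/2\<close> contributes at most
  \<open>t/2\<close> to the average, so at least half of the mass comes from the points where \<open>g\<close> is large.
\<close>

lemma emeasure_le_stopped_integral:
  assumes [measurable]: "g \<in> borel_measurable M" and Q: "Q \<in> F" "ennreal t < average M Q g" and t: "0 < t"
  shows "ennreal t * emeasure M Q
           \<le> 2 * (\<integral>\<^sup>+x\<in>Q. g x * indicator {x. ennreal t < 2 * g x} x \<partial>M)" (is "_ \<le> 2 * ?X")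
proof -
  note [measurable] = sets_F[OF Q(1)]
  let ?A = "ennreal (t / 2) * emeasure M Q"
  have half: "ennreal t = ennreal (t/2) + ennreal (t/2)" 
    using t by (simp flip: ennreal_plus)
  have "?A + ?A = ennreal t * emeasure M Q" by (simp add: half distrib_right)
  also have "\<dots> \<le> average M Q g * emeasure M Q"
    using Q by (intro mult_right_mono) auto
  also have "\<dots> = (\<integral>\<^sup>+x\<in>Q. g x \<partial>M)" by (rule average_times_emeasure[OF Q(1)])
  also have "\<dots> \<le> (\<integral>\<^sup>+x. g x * indicator {x. ennreal t < 2 * g x} x * indicator Q x
                        + ennreal (t/2) * indicator Q x \<partial>M)"
  proof (rule nn_integral_mono)
    fix x
    have "g x \<le> ennreal (t/2)" if "\<not> ennreal t < 2 * g x"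
    proof -
      have "2 * g x \<le> 2 * ennreal (t/2)"
        using that t by (simp add: half mult_2 del: ennreal_plus)
      then show ?thesis by (simp add: ennreal_mult_le_mult_iff)
    qed
    then show "g x * indicator Q x \<le> g x * indicator {x. ennreal t < 2 * g x} x * indicator Q x
        + ennreal (t/2) * indicator Q x"
      by (auto split: split_indicator)
  qed
  also have "\<dots> = ?X + ?A"
    by (subst nn_integral_add) (auto simp: nn_integral_cmult_indicator)
  finally have "?A \<le> ?X"
    using emeasure_F(2)[OF Q(1)] by (simp add: add.commute[of ?X] ennreal_mult_eq_top_iff)
  then show ?thesis
    by (simp add: half distrib_right mult_2 add_mono)
qed

text \<open>
  The level set is the disjoint union of the maximal sets \<open>Q\<close> with average of \<open>g\<close> above \<open>t\<close>. On each
  of them the \<open>w\<close>-mass is the measure of \<open>Q\<close> times the average of \<open>w\<close>, and on \<open>Q\<close> this average is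
  dominated by the maximal function of \<open>w\<close>.
\<close>

lemma maximal_weak_type:
  assumes [measurable]: "g \<in> borel_measurable M" "w \<in> borel_measurable M" and t: "0 < t"
  shows "ennreal t * (\<integral>\<^sup>+x\<in>{x. ennreal t < maximal g x}. w x \<partial>M)
           \<le> 2 * (\<integral>\<^sup>+x\<in>{x. ennreal t < 2 * g x}. g x * maximal w x \<partial>M)"
proof -
  define G where "G = {Q \<in> F. ennreal t < average M Q g}"
  \<comment> \<open>The disjoint sets covering the level set are the maximal ones among those with large average.\<close>
  define G' where "G' = {Q \<in> G. \<forall>P\<in>G. Q \<subseteq> P \<longrightarrow> Q = P}"
  have fin: "finite G" "finite G'" using finite_F by (auto simp: G_def G'_def)
  have sub: "G' \<subseteq> G" "G \<subseteq> F" by (auto simp: G_def G'_def)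
  have [measurable]: "Q \<in> sets M" if "Q \<in> G'" for Q using that sub sets_F by auto
  have disj: "disjoint_family_on (\<lambda>Q. Q) G'"
    unfolding disjoint_family_on_def
  proof (intro ballI impI)
    fix P Q assume PQ: "P \<in> G'" "Q \<in> G'" "P \<noteq> Q"
    then have "\<not> P \<subseteq> Q" "\<not> Q \<subseteq> P" by (auto simp: G'_def)
    then show "P \<inter> Q = {}" using laminar[of P Q] PQ sub by auto
  qed
  have ind: "(\<Sum>Q\<in>G'. indicator Q x) = (indicator (\<Union>G') x :: ennreal)" for x
    by (rule indicator_UN_disjoint[OF fin(2) disj, simplified, symmetric])
  have cover: "x \<in> \<Union>G'" if x: "ennreal t < maximal g x" for x
  proof -
    obtain Q where "Q \<in> F" "ennreal t < average M Q g * indicator Q x"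
      using x by (auto simp: maximal_def less_SUP_iff)
    then have "Q \<in> G" "x \<in> Q" by (auto simp: G_def split: split_indicator_asm)
    then show ?thesis
      using finite_has_maximal2[OF fin(1) \<open>Q \<in> G\<close>] by (auto simp: G'_def)
  qed
  let ?h = "\<lambda>x. g x * indicator {x. ennreal t < 2 * g x} x"
  have "ennreal t * (\<integral>\<^sup>+x\<in>{x. ennreal t < maximal g x}. w x \<partial>M)
      \<le> ennreal t * (\<integral>\<^sup>+x. (\<Sum>Q\<in>G'. w x * indicator Q x) \<partial>M)"
    using cover by (intro mult_left_mono nn_integral_mono)
      (auto simp: ind sum_distrib_left[symmetric] split: split_indicator)
  also have "\<dots> = (\<Sum>Q\<in>G'. ennreal t * (\<integral>\<^sup>+x\<in>Q. w x \<partial>M))"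
    by (subst nn_integral_sum) (auto simp: sum_distrib_left)
  also have "\<dots> \<le> (\<Sum>Q\<in>G'. 2 * (\<integral>\<^sup>+x\<in>Q. ?h x * maximal w x \<partial>M))"
  proof (rule sum_mono)
    fix Q assume "Q \<in> G'"
    then have Q: "Q \<in> F" "ennreal t < average M Q g" by (auto simp: G_def G'_def)
    note [measurable] = sets_F[OF Q(1)]
    have "ennreal t * (\<integral>\<^sup>+x\<in>Q. w x \<partial>M) = ennreal t * emeasure M Q * average M Q w"
      by (simp add: average_times_emeasure[OF Q(1), symmetric] mult_ac)
    also have "\<dots> \<le> 2 * (\<integral>\<^sup>+x\<in>Q. ?h x \<partial>M) * average M Q w"
      by (intro mult_right_mono emeasure_le_stopped_integral Q t) auto
    also have "\<dots> = 2 * (\<integral>\<^sup>+x\<in>Q. ?h x * average M Q w \<partial>M)"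
      by (simp add: mult.assoc flip: nn_integral_multc) (simp add: mult_ac)
    also have "\<dots> \<le> 2 * (\<integral>\<^sup>+x\<in>Q. ?h x * maximal w x \<partial>M)"
      using Q by (intro mult_left_mono nn_integral_mono)
        (auto split: split_indicator intro!: mult_left_mono average_le_maximal)
    finally show "ennreal t * (\<integral>\<^sup>+x\<in>Q. w x \<partial>M) \<le> 2 * (\<integral>\<^sup>+x\<in>Q. ?h x * maximal w x \<partial>M)" .
  qed
  also have "\<dots> = 2 * (\<integral>\<^sup>+x. (\<Sum>Q\<in>G'. ?h x * maximal w x * indicator Q x) \<partial>M)"
    by (subst nn_integral_sum) (auto simp: sum_distrib_left)
  also have "\<dots> \<le> 2 * (\<integral>\<^sup>+x\<in>{x. ennreal t < 2 * g x}. g x * maximal w x \<partial>M)"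
    by (intro mult_left_mono nn_integral_mono)
      (auto simp: ind sum_distrib_left[symmetric] split: split_indicator)
  finally show ?thesis .
qed

text \<open>
  The weighted inequality of Fefferman and Stein. The truncation at \<open>t/2\<close> in the weak type estimate
  is what makes the integral over all levels \<open>t\<close> converge to a multiple of the \<open>q\<close>-th power of \<open>g\<close>.
\<close>

lemma maximal_weighted_bound:
  assumes [measurable]: "g \<in> borel_measurable M" "w \<in> borel_measurable M" and q: "1 < q"
  shows "(\<integral>\<^sup>+x. enn_powr (maximal g x) q * w x \<partial>M)
           \<le> maximal_const q * (\<integral>\<^sup>+x. enn_powr (g x) q * maximal w x \<partial>M)"
proof -
  interpret pair_sigma_finite lborel M ..
  let ?S = "\<lambda>a t. indicator {t. 0 < t \<and> ennreal t < a} t :: ennreal"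
  have "(\<integral>\<^sup>+x. enn_powr (maximal g x) q * w x \<partial>M)
      = (\<integral>\<^sup>+x. \<integral>\<^sup>+t. ennreal q * ennreal (t powr (q - 1)) * ?S (maximal g x) t * w x \<partial>lborel \<partial>M)"
  proof (rule nn_integral_cong)
    fix x
    have "(\<integral>\<^sup>+t. ennreal q * ennreal (t powr (q - 1)) * ?S (maximal g x) t * w x \<partial>lborel)
        = ennreal q * (\<integral>\<^sup>+t. ennreal (t powr (q - 1)) * ?S (maximal g x) t \<partial>lborel) * w x"
      by (subst nn_integral_multc, simp, simp add: mult.assoc nn_integral_cmult)
    also have "\<dots> = enn_powr (maximal g x) q * w x"
      using q by (subst layer_cake) (auto simp: ennreal_times_divide mult.commute[of "ennreal q"] ennreal_mult_divide_eq)
    finally show "enn_powr (maximal g x) q * w x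
      = (\<integral>\<^sup>+t. ennreal q * ennreal (t powr (q - 1)) * ?S (maximal g x) t * w x \<partial>lborel)" ..
  qed
  also have "\<dots> = (\<integral>\<^sup>+t. \<integral>\<^sup>+x. ennreal q * ennreal (t powr (q - 1)) * ?S (maximal g x) t * w x \<partial>M \<partial>lborel)"
    by (rule Fubini') measurable
  also have "\<dots> \<le> (\<integral>\<^sup>+t. \<integral>\<^sup>+x. ennreal (2 * q) * ennreal (t powr (q - 1 - 1)) * ?S (2 * g x) t * (g x * maximal w x) \<partial>M \<partial>lborel)"
  proof (rule nn_integral_mono)
    fix t :: real
    show "(\<integral>\<^sup>+x. ennreal q * ennreal (t powr (q - 1)) * ?S (maximal g x) t * w x \<partial>M)
      \<le> (\<integral>\<^sup>+x. ennreal (2 * q) * ennreal (t powr (q - 1 - 1)) * ?S (2 * g x) t * (g x * maximal w x) \<partial>M)"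
    proof (cases "0 < t")
      case True
      have S: "?S a t = indicator {x. ennreal t < b x} y" if "a = b y" for a b and y :: 'a
        using True that by (auto split: split_indicator)
      have split: "ennreal (t powr (q - 1)) = ennreal (t powr (q - 1 - 1)) * ennreal t"
        using True by (simp add: powr_diff ennreal_mult[symmetric] power2_eq_square)
      have "(\<integral>\<^sup>+x. ennreal q * ennreal (t powr (q - 1)) * ?S (maximal g x) t * w x \<partial>M)
          = ennreal q * ennreal (t powr (q - 1)) * (\<integral>\<^sup>+x\<in>{x. ennreal t < maximal g x}. w x \<partial>M)"
        by (subst nn_integral_cmult[symmetric]) (auto intro!: nn_integral_cong simp: S[of _ "maximal g"] mult_ac)
      also have "\<dots> = ennreal q * ennreal (t powr (q - 1 - 1)) * (ennreal t * (\<integral>\<^sup>+x\<in>{x. ennreal t < maximal g x}. w x \<partial>M))"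
        by (simp only: split mult_ac)
      also have "\<dots> \<le> ennreal q * ennreal (t powr (q - 1 - 1)) *
          (2 * (\<integral>\<^sup>+x\<in>{x. ennreal t < 2 * g x}. g x * maximal w x \<partial>M))"
        by (intro mult_left_mono maximal_weak_type True) auto
      also have "\<dots> = ennreal (2 * q) * ennreal (t powr (q - 1 - 1)) * (\<integral>\<^sup>+x\<in>{x. ennreal t < 2 * g x}. g x * maximal w x \<partial>M)"
        using q by (simp add: ennreal_mult mult_ac)
      also have "\<dots> = (\<integral>\<^sup>+x. ennreal (2 * q) * ennreal (t powr (q - 1 - 1)) * ?S (2 * g x) t * (g x * maximal w x) \<partial>M)"
        by (subst nn_integral_cmult[symmetric])
          (auto intro!: nn_integral_cong simp: S[of _ "\<lambda>x. 2 * g x"] mult_ac)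
      finally show ?thesis .
    qed simp
  qed
  also have "\<dots> = (\<integral>\<^sup>+x. \<integral>\<^sup>+t. ennreal (2 * q) * ennreal (t powr (q - 1 - 1)) * ?S (2 * g x) t * (g x * maximal w x) \<partial>lborel \<partial>M)"
    by (rule Fubini'[symmetric]) measurable
  also have "\<dots> = (\<integral>\<^sup>+x. ennreal (2 powr q * q / (q - 1)) * (enn_powr (g x) q * maximal w x) \<partial>M)"
  proof (rule nn_integral_cong)
    fix x
    have "(\<integral>\<^sup>+t. ennreal (2 * q) * ennreal (t powr (q - 1 - 1)) * ?S (2 * g x) t * (g x * maximal w x) \<partial>lborel)
        = ennreal (2 * q) * (\<integral>\<^sup>+t. ennreal (t powr (q - 1 - 1)) * ?S (2 * g x) t \<partial>lborel) * (g x * maximal w x)"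
      by (subst nn_integral_multc, simp, simp add: mult.assoc nn_integral_cmult)
    also have "\<dots> = ennreal (2 * q) * (enn_powr 2 (q - 1) * enn_powr (g x) (q - 1) / ennreal (q - 1)) * (g x * maximal w x)"
      using q by (subst layer_cake) (auto simp: enn_powr_mult)
    also have "\<dots> = ennreal (2 * q) * (ennreal (2 powr (q - 1)) * inverse (ennreal (q - 1)))
        * (enn_powr (g x) (q - 1) * enn_powr (g x) 1) * maximal w x"
      by (simp add: divide_ennreal_def mult_ac enn_powr_ennreal flip: ennreal_numeral)
    also have "ennreal (2 * q) * (ennreal (2 powr (q - 1)) * inverse (ennreal (q - 1))) = ennreal (2 powr q * q / (q - 1))"
      using q by (simp add: inverse_ennreal ennreal_mult[symmetric] powr_diff field_simps)
    also have "enn_powr (g x) (q - 1) * enn_powr (g x) 1 = enn_powr (g x) q"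
      unfolding enn_powr_add[symmetric] by simp
    finally show "(\<integral>\<^sup>+t. ennreal (2 * q) * ennreal (t powr (q - 1 - 1)) * ?S (2 * g x) t * (g x * maximal w x) \<partial>lborel)
      = ennreal (2 powr q * q / (q - 1)) * (enn_powr (g x) q * maximal w x)"
      by (simp add: mult.assoc)
  qed
  also have "\<dots> = ennreal (2 powr q * q / (q - 1)) * (\<integral>\<^sup>+x. enn_powr (g x) q * maximal w x \<partial>M)"
    by (rule nn_integral_cmult) measurable
  finally show ?thesis unfolding maximal_const_def .
qed

lemma maximal_bound:
  assumes [measurable]: "g \<in> borel_measurable M" and q: "1 < q"
  shows "(\<integral>\<^sup>+x. enn_powr (maximal g x) q \<partial>M) 
           \<le> maximal_const q * (\<integral>\<^sup>+x. enn_powr (g x) q \<partial>M)"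
proof -
  have "maximal (\<lambda>_. 1) x \<le> 1" for x
    using emeasure_F by (intro maximal_le) (simp add: average_def sets_F ennreal_divide_self less_top)
  then have "(\<integral>\<^sup>+x. enn_powr (g x) q * maximal (\<lambda>_. 1) x \<partial>M) \<le> (\<integral>\<^sup>+x. enn_powr (g x) q * 1 \<partial>M)"
    by (intro nn_integral_mono mult_left_mono) auto
  with maximal_weighted_bound[of g "\<lambda>_. 1" q] q show ?thesis
    by simp (meson assms(1) dual_order.trans mult_left_mono zero_le)
qed
end

section \<open>The vector-valued maximal inequality\<close>

text \<open>
  The \<open>\<ell>\<^sup>r\<close> norm over finitely many indices. A sequence \<open>c\<close> of finite norm is its norm times
  the direction \<open>c j / lr_norm r J c\<close>, which has norm one unless \<open>c\<close> vanishes; in that case the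
  convention \<open>0 / 0 = 0\<close> of extended nonnegative reals keeps the factorisation correct. Dual sequences are built below
  from powers of the direction and of the norm, which avoids negative exponents.
\<close>

definition lr_norm :: "real \<Rightarrow> 'j set \<Rightarrow> ('j \<Rightarrow> ennreal) \<Rightarrow> ennreal" where
  "lr_norm r J c = enn_powr (\<Sum>j\<in>J. enn_powr (c j) r) (1 / r)"

lemma lr_norm_powr: "r \<noteq> 0 \<Longrightarrow> enn_powr (lr_norm r J c) p = enn_powr (\<Sum>j\<in>J. enn_powr (c j) r) (p / r)"
  by (simp add: lr_norm_def enn_powr_powr)

lemma lr_norm_powr_self: "r \<noteq> 0 \<Longrightarrow> enn_powr (lr_norm r J c) r = (\<Sum>j\<in>J. enn_powr (c j) r)"
  by (simp add: lr_norm_powr)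

lemma measurable_lr_norm [measurable]:
  "(\<And>j. j \<in> J \<Longrightarrow> f j \<in> borel_measurable M) \<Longrightarrow> (\<lambda>x. lr_norm r J (\<lambda>j. f j x)) \<in> borel_measurable M"
  unfolding lr_norm_def by measurable

lemma le_lr_norm:
  assumes "finite J" "j \<in> J" "0 < r"
  shows "c j \<le> lr_norm r J c"
proof -
  have "enn_powr (enn_powr (c j) r) (1 / r) \<le> lr_norm r J c"
    unfolding lr_norm_def using assms by (intro enn_powr_mono member_le_sum) auto
  then show ?thesis using assms by (simp add: enn_powr_powr)
qed

lemma lr_norm_mono:
  assumes "\<And>j. j \<in> J \<Longrightarrow> c j \<le> d j" "0 < r"
  shows "lr_norm r J c \<le> lr_norm r J d"
  unfolding lr_norm_def using assms by (intro enn_powr_mono sum_mono) auto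

lemma lr_norm_finite:
  assumes "finite J" "\<And>j. j \<in> J \<Longrightarrow> c j \<noteq> top"
  shows "lr_norm r J c \<noteq> top"
  using assms by (simp add: lr_norm_def)

lemma lr_direction:
  assumes J: "finite J" "j \<in> J" and r: "0 < r" and fin: "lr_norm r J c \<noteq> top"
  shows "c j / lr_norm r J c * lr_norm r J c = c j"
  using le_lr_norm[OF J r, of c] fin
  by (cases "lr_norm r J c = 0") (simp_all add: ennreal_divide_times less_top)

lemma lr_direction_norm:
  assumes r: "0 < r" and fin: "lr_norm r J c \<noteq> top" "lr_norm r J c \<noteq> 0"
  shows "(\<Sum>j\<in>J. enn_powr (c j / lr_norm r J c) r) = 1"
proof -
  let ?N = "lr_norm r J c"
  have "(\<Sum>j\<in>J. enn_powr (c j / ?N) r) = (\<Sum>j\<in>J. enn_powr (c j) r) * enn_powr (inverse ?N) r"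
    by (simp add: divide_ennreal_def enn_powr_mult sum_distrib_right)
  also have "\<dots> = enn_powr (?N * inverse ?N) r"
    using r by (simp add: enn_powr_mult lr_norm_powr_self)
  also have "\<dots> = 1" using fin by (simp add: divide_ennreal_def[symmetric] less_top)
  finally show ?thesis .
qed

lemma lr_direction_norm_times:
  assumes r: "0 < r" and "lr_norm r J c \<noteq> top" 
  shows "(\<Sum>j\<in>J. enn_powr (c j / lr_norm r J c) r * enn_powr (lr_norm r J c) p) = enn_powr (lr_norm r J c) p"
  using lr_direction_norm[OF assms] 
  by (cases "lr_norm r J c = 0") (simp_all flip: sum_distrib_right)

lemma lr_Hoelder:
  assumes "finite J" and r: "1 < r" and r': "1/r + 1/r' = 1"
  shows "(\<Sum>j\<in>J. c j * d j) \<le> lr_norm r J c * lr_norm r' J d"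
proof -
  have "1 / r < 1" "0 < 1 / r" "r \<noteq> 0" using r by auto
  then have "0 < 1 / r" "0 < 1 / r'" "r \<noteq> 0" using r' by linarith+
  moreover have "r' \<noteq> 0" using \<open>0 < 1/r'\<close> by auto
  ultimately show ?thesis
    using sum_Hoelder[OF \<open>finite J\<close>, of "1/r" "1/r'" "\<lambda>j. enn_powr (c j) r" "\<lambda>j. enn_powr (d j) r'"] r'
    by (simp add: lr_norm_def enn_powr_powr)
qed

context laminar_family
begin

lemma average_Hoelder:
  assumes [measurable]: "u \<in> borel_measurable M" "v \<in> borel_measurable M"
    and Q: "Q \<in> F" and ab: "0 < a" "0 < b" "a + b = (1::real)"
  shows "average M Q (\<lambda>x. enn_powr (u x) a * enn_powr (v x) b)
           \<le> enn_powr (average M Q u) a * enn_powr (average M Q v) b"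
proof -
  note [measurable] = sets_F[OF Q]
  let ?m = "emeasure M Q"
  have "(\<integral>\<^sup>+x\<in>Q. enn_powr (u x) a * enn_powr (v x) b \<partial>M)
      = (\<integral>\<^sup>+x. enn_powr (u x * indicator Q x) a * enn_powr (v x * indicator Q x) b \<partial>M)"
    by (intro nn_integral_cong) (auto split: split_indicator)
  also have "\<dots> \<le> enn_powr (\<integral>\<^sup>+x\<in>Q. u x \<partial>M) a * enn_powr (\<integral>\<^sup>+x\<in>Q. v x \<partial>M) b"
    by (rule nn_integral_Hoelder) (use ab in auto)
  also have "\<dots> = enn_powr (average M Q u) a * enn_powr (average M Q v) b * (enn_powr ?m a * enn_powr ?m b)"
    by (simp add: average_times_emeasure[OF Q, symmetric] enn_powr_mult mult_ac)
  also have "enn_powr ?m a * enn_powr ?m b = ?m"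
    using ab by (simp flip: enn_powr_add)
  finally have "(\<integral>\<^sup>+x\<in>Q. enn_powr (u x) a * enn_powr (v x) b \<partial>M) / ?m
      \<le> enn_powr (average M Q u) a * enn_powr (average M Q v) b * ?m / ?m"
    by (rule divide_right_mono_ennreal)
  then show ?thesis
    unfolding average_def[of M Q "\<lambda>x. enn_powr (u x) a * enn_powr (v x) b"]
    using emeasure_F[OF Q] by (simp add: mult_divide_eq_ennreal)
qed

lemma maximal_Hoelder:
  assumes "u \<in> borel_measurable M" "v \<in> borel_measurable M"
    and ab: "0 < a" "0 < b" "a + b = (1::real)"
  shows "maximal (\<lambda>x. enn_powr (u x) a * enn_powr (v x) b) x
           \<le> enn_powr (maximal u x) a * enn_powr (maximal v x) b"
proof (rule maximal_le)
  fix Q assume Q: "Q \<in> F" "x \<in> Q"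
  have "average M Q (\<lambda>x. enn_powr (u x) a * enn_powr (v x) b)
           \<le> enn_powr (average M Q u) a * enn_powr (average M Q v) b"
    by (rule average_Hoelder[OF assms(1,2) Q(1) ab])
  also have "\<dots> \<le> enn_powr (maximal u x) a * enn_powr (maximal v x) b"
    using ab Q by (intro mult_mono enn_powr_mono average_le_maximal) auto
  finally show "average M Q (\<lambda>x. enn_powr (u x) a * enn_powr (v x) b)
      \<le> enn_powr (maximal u x) a * enn_powr (maximal v x) b" .
qed

lemma average_finite:
  assumes [measurable]: "f \<in> borel_measurable M" and p: "1 \<le> p"
    and fin: "(\<integral>\<^sup>+x. enn_powr (f x) p \<partial>M) \<noteq> top" and Q: "Q \<in> F"
  shows "average M Q f \<noteq> top"
proof -
  note [measurable] = sets_F[OF Q]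
  have "(\<integral>\<^sup>+x\<in>Q. f x \<partial>M) \<le> (\<integral>\<^sup>+x. indicator Q x + enn_powr (f x) p \<partial>M)"
    using le_1_plus_enn_powr[OF p] by (intro nn_integral_mono) (auto split: split_indicator)
  also have "\<dots> = emeasure M Q + (\<integral>\<^sup>+x. enn_powr (f x) p \<partial>M)"
    by (subst nn_integral_add) auto
  also have "\<dots> < top" using fin emeasure_F[OF Q] by (simp add: less_top)
  finally show ?thesis
    using emeasure_F[OF Q] by (simp add: average_def ennreal_divide_eq_top_iff)
qed

text \<open>
  Supplies the a priori finiteness that \<open>enn_powr_absorb\<close> asks for.
\<close>

lemma bounded_on_F_integral_finite:
  assumes "\<And>x. u x \<le> c * indicator (\<Union>F) x" "c \<noteq> top" "0 < p"
  shows "(\<integral>\<^sup>+x. enn_powr (u x) p \<partial>M) \<noteq> top"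
proof -
  have meas: "\<Union>F \<in> sets M" using finite_F sets_F by auto
  have "(\<integral>\<^sup>+x. enn_powr (u x) p \<partial>M) \<le> (\<integral>\<^sup>+x. enn_powr c p * indicator (\<Union>F) x \<partial>M)"
  proof (rule nn_integral_mono)
    fix x
    have "enn_powr (u x) p \<le> enn_powr (c * indicator (\<Union>F) x) p"
      by (intro enn_powr_mono assms)
    then show "enn_powr (u x) p \<le> enn_powr c p * indicator (\<Union>F) x"
      by (auto split: split_indicator_asm split_indicator)
  qed
  also have "\<dots> = enn_powr c p * emeasure M (\<Union>F)"
    by (rule nn_integral_cmult_indicator[OF meas])
  also have "\<dots> < top"
  proof -
    have "emeasure M (\<Union>F) \<le> (\<Sum>Q\<in>F. emeasure M Q)"
      using emeasure_subadditive_finite[OF finite_F, of "\<lambda>Q. Q" M] sets_F by (auto simp: subset_iff)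
    also have "\<dots> < top" using finite_F emeasure_F by (simp add: less_top[symmetric])
    finally show ?thesis using assms by (simp add: ennreal_mult_eq_top_iff less_top[symmetric])
  qed
  finally show ?thesis by simp
qed

lemma maximal_le_sum_average: "maximal f x \<le> (\<Sum>Q\<in>F. average M Q f) * indicator (\<Union>F) x"
proof (cases "x \<in> \<Union>F")
  case True
  then show ?thesis
    by (auto intro!: maximal_le member_le_sum finite_F)
next
  case False
  then show ?thesis using maximal_le[of x f 0] by auto
qed

text \<open>
  For \<open>p < r\<close> write \<open>f\<^sub>j = \<phi>\<^sub>j\<^bsup>p/r\<^esup> N\<^bsup>1-p/r\<^esup>\<close>, where \<open>N\<close> is the pointwise \<open>\<ell>\<^sup>r\<close> norm of the sequence.
  Hoelder's inequality for averages bounds the maximal function of \<open>f\<^sub>j\<close> by the same product of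
  maximal functions. The second factor does not depend on \<open>j\<close>, so only the scalar inequality on
  \<open>L\<^sup>p\<close> is needed, applied to \<open>N\<close> and to each \<open>\<phi>\<^sub>j\<close>; the \<open>p\<close>-th powers of the \<open>\<phi>\<^sub>j\<close> add up to \<open>N\<^sup>p\<close>.
\<close>

lemma vector_maximal_bound_le:
  assumes J: "finite J" and [measurable]: "\<And>j. j \<in> J \<Longrightarrow> f j \<in> borel_measurable M"
    and fin: "\<And>j x. j \<in> J \<Longrightarrow> f j x \<noteq> top" and p: "1 < p" "p \<le> r"
  shows "(\<integral>\<^sup>+x. enn_powr (lr_norm r J (\<lambda>j. maximal (f j) x)) p \<partial>M)
           \<le> maximal_const p * (\<integral>\<^sup>+x. enn_powr (lr_norm r J (\<lambda>j. f j x)) p \<partial>M)"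
proof (cases "p = r")
  case True
  have "(\<integral>\<^sup>+x. enn_powr (lr_norm r J (\<lambda>j. maximal (f j) x)) p \<partial>M)
      = (\<Sum>j\<in>J. \<integral>\<^sup>+x. enn_powr (maximal (f j) x) p \<partial>M)"
    using True p by (simp add: lr_norm_powr_self nn_integral_sum)
  also have "\<dots> \<le> (\<Sum>j\<in>J. maximal_const p * \<integral>\<^sup>+x. enn_powr (f j x) p \<partial>M)"
    using p by (intro sum_mono maximal_bound) auto
  also have "\<dots> = maximal_const p * (\<integral>\<^sup>+x. enn_powr (lr_norm r J (\<lambda>j. f j x)) p \<partial>M)"
    using True p by (simp add: lr_norm_powr_self nn_integral_sum sum_distrib_left)
  finally show ?thesis .
next
  case False
  define N where "N x = lr_norm r J (\<lambda>j. f j x)" for x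
  define \<theta> where "\<theta> j x = f j x / N x" for j x
  define \<phi> where "\<phi> j x = enn_powr (\<theta> j x) (r / p) * N x" for j x
  define b where "b = 1 - p / r"
  have r: "0 < r" and b: "0 < b" "p / r + b = 1" "0 < p / r" using p False by (auto simp: b_def)
  have [measurable]: "N \<in> borel_measurable M" 
    unfolding N_def[abs_def] by measurable
  have [measurable]: "\<phi> j \<in> borel_measurable M" if "j \<in> J" for j
    using that unfolding \<phi>_def[abs_def] \<theta>_def by measurable
  have N_fin: "N x \<noteq> top" for x unfolding N_def using J fin by (rule lr_norm_finite)
  have f_eq: "f j x = enn_powr (\<phi> j x) (p / r) * enn_powr (N x) b" if "j \<in> J" for j x
  proof -
    have "enn_powr (\<phi> j x) (p / r) * enn_powr (N x) b = \<theta> j x * (enn_powr (N x) (p / r) * enn_powr (N x) b)"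
      using p r by (simp add: \<phi>_def enn_powr_mult enn_powr_powr mult.assoc)
    also have "\<dots> = \<theta> j x * N x" by (simp add: b flip: enn_powr_add)
    also have "\<dots> = f j x"
      unfolding \<theta>_def N_def by (rule lr_direction) (use that J r N_fin[unfolded N_def] in auto)
    finally show ?thesis ..
  qed
  have \<phi>_sum: "(\<Sum>j\<in>J. enn_powr (\<phi> j x) p) = enn_powr (N x) p" for x
    using lr_direction_norm_times[of r J "\<lambda>j. f j x" p] r p N_fin[of x, unfolded N_def]
    by (simp add: \<phi>_def \<theta>_def N_def enn_powr_mult enn_powr_powr)
  let ?X = "\<lambda>x. \<Sum>j\<in>J. enn_powr (maximal (\<phi> j) x) p" and ?Y = "\<lambda>x. enn_powr (maximal N x) p"
  have "(\<integral>\<^sup>+x. enn_powr (lr_norm r J (\<lambda>j. maximal (f j) x)) p \<partial>M)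
      \<le> (\<integral>\<^sup>+x. enn_powr (?X x) (p / r) * enn_powr (?Y x) b \<partial>M)"
  proof (rule nn_integral_mono)
    fix x
    have "(\<Sum>j\<in>J. enn_powr (maximal (f j) x) r)
        \<le> (\<Sum>j\<in>J. enn_powr (enn_powr (maximal (\<phi> j) x) (p / r) * enn_powr (maximal N x) b) r)"
    proof (intro sum_mono enn_powr_mono r)
      fix j assume j: "j \<in> J"
      then have "f j = (\<lambda>x. enn_powr (\<phi> j x) (p / r) * enn_powr (N x) b)"
        using f_eq by blast
      then show "maximal (f j) x \<le> enn_powr (maximal (\<phi> j) x) (p / r) * enn_powr (maximal N x) b"
        using maximal_Hoelder[of "\<phi> j" N "p / r" b x] b j by simp
    qed
    also have "\<dots> = ?X x * enn_powr (maximal N x) (b * r)"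
      using r by (simp add: enn_powr_mult enn_powr_powr sum_distrib_right)
    finally have "enn_powr (\<Sum>j\<in>J. enn_powr (maximal (f j) x) r) (p / r)
        \<le> enn_powr (?X x * enn_powr (maximal N x) (b * r)) (p / r)"
      using b by (intro enn_powr_mono)
    also have "\<dots> = enn_powr (?X x) (p / r) * enn_powr (?Y x) b"
      using r by (simp add: enn_powr_mult enn_powr_powr mult_ac)
    finally show "enn_powr (lr_norm r J (\<lambda>j. maximal (f j) x)) p \<le> enn_powr (?X x) (p / r) * enn_powr (?Y x) b"
      using r by (simp add: lr_norm_powr)
  qed
  also have "\<dots> \<le> enn_powr (\<integral>\<^sup>+x. ?X x \<partial>M) (p / r) * enn_powr (\<integral>\<^sup>+x. ?Y x \<partial>M) b"
    using b by (intro nn_integral_Hoelder) auto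
  also have "\<dots> \<le> enn_powr (maximal_const p * (\<integral>\<^sup>+x. enn_powr (N x) p \<partial>M)) (p / r)
      * enn_powr (maximal_const p * (\<integral>\<^sup>+x. enn_powr (N x) p \<partial>M)) b"
  proof (intro mult_mono enn_powr_mono b)
    have "(\<integral>\<^sup>+x. ?X x \<partial>M) = (\<Sum>j\<in>J. \<integral>\<^sup>+x. enn_powr (maximal (\<phi> j) x) p \<partial>M)"
      by (rule nn_integral_sum) measurable
    also have "\<dots> \<le> (\<Sum>j\<in>J. maximal_const p * (\<integral>\<^sup>+x. enn_powr (\<phi> j x) p \<partial>M))"
      using p by (intro sum_mono maximal_bound) auto
    also have "\<dots> = maximal_const p * (\<integral>\<^sup>+x. (\<Sum>j\<in>J. enn_powr (\<phi> j x) p) \<partial>M)"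
      by (simp add: sum_distrib_left nn_integral_sum)
    finally show "(\<integral>\<^sup>+x. ?X x \<partial>M) \<le> maximal_const p * (\<integral>\<^sup>+x. enn_powr (N x) p \<partial>M)"
      by (simp add: \<phi>_sum)
    show "(\<integral>\<^sup>+x. ?Y x \<partial>M) \<le> maximal_const p * (\<integral>\<^sup>+x. enn_powr (N x) p \<partial>M)"
      using p by (intro maximal_bound) auto
  qed auto
  also have "\<dots> = maximal_const p * (\<integral>\<^sup>+x. enn_powr (N x) p \<partial>M)"
    by (simp add: b flip: enn_powr_add)
  finally show ?thesis by (simp add: N_def)
qed

text \<open>
  For \<open>p > r\<close> the \<open>L\<^bsup>p/r\<^esup>\<close> norm of \<open>V = \<Sum>\<^sub>j (M f\<^sub>j)\<^sup>r\<close> is computed by testing against its extremal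
  weight \<open>w = V\<^bsup>q-1\<^esup>\<close>, \<open>q = p/r\<close>. The weighted inequality with exponent \<open>r\<close> moves the maximal operator
  from the \<open>f\<^sub>j\<close> to \<open>w\<close>, where it is removed by the scalar inequality with the exponent conjugate
  to \<open>q\<close>.
\<close>

lemma vector_maximal_bound_ge:
  assumes J: "finite J" and [measurable]: "\<And>j. j \<in> J \<Longrightarrow> f j \<in> borel_measurable M"
    and r: "1 < r" "r < p" and q: "q = p / r"
  shows "(\<integral>\<^sup>+x. enn_powr (lr_norm r J (\<lambda>j. maximal (f j) x)) p \<partial>M)
           \<le> enn_powr (maximal_const r * enn_powr (maximal_const (q / (q - 1))) (1 - 1/q)) q
              * (\<integral>\<^sup>+x. enn_powr (lr_norm r J (\<lambda>j. f j x)) p \<partial>M)"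
    (is "?L \<le> enn_powr ?K q * ?R")
proof (cases "?R = top")
  case True
  have "enn_powr ?K q \<noteq> 0"
  proof -
    have "1 < q" using r q by simp
    then have "1 < q / (q - 1)" by (simp add: field_simps)
    then show ?thesis using r maximal_const_pos by simp
  qed
  then show ?thesis using True by (simp add: ennreal_mult_top)
next
  case False
  define q' where "q' = q / (q - 1)"
  have q1: "1 < q" "1 < q'" "0 < 1 - 1/q" "0 < 1/q" "q * r = p" "q' * (1 - 1/q) = 1" "(q - 1) * q' = q"
    using r q by (auto simp: q'_def field_simps)
  have p: "1 < p" using r by simp
  define V where "V x = (\<Sum>j\<in>J. enn_powr (maximal (f j) x) r)" for x
  define w where "w x = enn_powr (V x) (q - 1)" for x
  let ?S = "\<lambda>x. \<Sum>j\<in>J. enn_powr (f j x) r"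
  have [measurable]: "V \<in> borel_measurable M" unfolding V_def[abs_def] by measurable
  have [measurable]: "w \<in> borel_measurable M" unfolding w_def[abs_def] by measurable
  have V: "?L = (\<integral>\<^sup>+x. enn_powr (V x) q \<partial>M)" and R: "?R = (\<integral>\<^sup>+x. enn_powr (?S x) q \<partial>M)"
    using r q by (simp_all add: V_def lr_norm_powr)
  have f_fin: "(\<integral>\<^sup>+x. enn_powr (f j x) p \<partial>M) \<noteq> top" if "j \<in> J" for j
  proof -
    have "(\<integral>\<^sup>+x. enn_powr (f j x) p \<partial>M) \<le> ?R"
      using le_lr_norm[OF J that, of r] r by (intro nn_integral_mono enn_powr_mono) auto
    then show ?thesis using False by (auto simp: top_unique)
  qed
  \<comment> \<open>Each maximal function is bounded and lives on the union of \<open>F\<close>, as only finitely many finite averages occur.\<close>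
  have "?L \<noteq> top"
  proof (rule bounded_on_F_integral_finite)
    let ?c = "lr_norm r J (\<lambda>j. \<Sum>Q\<in>F. average M Q (f j))"
    show "?c \<noteq> top"
      using average_finite[OF _ _ f_fin] p finite_F by (intro lr_norm_finite J) auto
    show "lr_norm r J (\<lambda>j. maximal (f j) x) \<le> ?c * indicator (\<Union>F) x" for x
    proof -
      have "lr_norm r J (\<lambda>j. maximal (f j) x) \<le> lr_norm r J (\<lambda>j. (\<Sum>Q\<in>F. average M Q (f j)) * indicator (\<Union>F) x)"
        using r by (intro lr_norm_mono maximal_le_sum_average) auto
      also have "\<dots> = ?c * indicator (\<Union>F) x"
        by (auto split: split_indicator simp: lr_norm_def)
      finally show ?thesis .
    qed
  qed (use p in auto)
  then have L_fin: "(\<integral>\<^sup>+x. enn_powr (V x) q \<partial>M) \<noteq> top" by (simp add: V)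
  have "(\<integral>\<^sup>+x. enn_powr (V x) q \<partial>M) = (\<integral>\<^sup>+x. V x * w x \<partial>M)"
    using enn_powr_add[of _ 1 "q - 1"] by (simp add: w_def)
  also have "\<dots> = (\<Sum>j\<in>J. \<integral>\<^sup>+x. enn_powr (maximal (f j) x) r * w x \<partial>M)"
    by (simp add: V_def sum_distrib_right nn_integral_sum)
  also have "\<dots> \<le> (\<Sum>j\<in>J. maximal_const r * (\<integral>\<^sup>+x. enn_powr (f j x) r * maximal w x \<partial>M))"
    using r by (intro sum_mono maximal_weighted_bound) auto
  also have "\<dots> = maximal_const r * (\<integral>\<^sup>+x. ?S x * maximal w x \<partial>M)"
    by (simp add: sum_distrib_right sum_distrib_left nn_integral_sum)
  also have "(\<integral>\<^sup>+x. ?S x * maximal w x \<partial>M)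
      = (\<integral>\<^sup>+x. enn_powr (enn_powr (?S x) q) (1/q) * enn_powr (enn_powr (maximal w x) q') (1 - 1/q) \<partial>M)"
    using q1 by (simp add: enn_powr_powr)
  also have "maximal_const r * \<dots> \<le> maximal_const r * (enn_powr ?R (1/q)
      * enn_powr (\<integral>\<^sup>+x. enn_powr (maximal w x) q' \<partial>M) (1 - 1/q))"
    unfolding R using q1 by (intro mult_left_mono nn_integral_Hoelder) auto
  also have "\<dots> \<le> maximal_const r * (enn_powr ?R (1/q)
      * enn_powr (maximal_const q' * (\<integral>\<^sup>+x. enn_powr (w x) q' \<partial>M)) (1 - 1/q))"
    using q1 by (intro mult_left_mono enn_powr_mono maximal_bound) auto
  also have "(\<integral>\<^sup>+x. enn_powr (w x) q' \<partial>M) = (\<integral>\<^sup>+x. enn_powr (V x) q \<partial>M)"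
    using q1 by (simp add: w_def enn_powr_powr)
  finally have "(\<integral>\<^sup>+x. enn_powr (V x) q \<partial>M)
      \<le> (?K * enn_powr ?R (1/q)) * enn_powr (\<integral>\<^sup>+x. enn_powr (V x) q \<partial>M) (1 - 1/q)"
    by (simp add: enn_powr_mult q'_def mult_ac)
  then have "(\<integral>\<^sup>+x. enn_powr (V x) q \<partial>M) \<le> enn_powr (?K * enn_powr ?R (1/q)) (1 / (1/q))"
    by (rule enn_powr_absorb) (use L_fin q1 in auto)
  also have "\<dots> = enn_powr ?K q * ?R"
    using q1 by (simp add: enn_powr_mult enn_powr_powr)
  finally show ?thesis by (simp add: V)
qed

end

text \<open>
  The constants of the two cases; \<open>q / (q - 1)\<close> with \<open>q = p / r\<close> is the conjugate exponent.
\<close>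

definition vector_maximal_const :: "real \<Rightarrow> real \<Rightarrow> ennreal" where
  "vector_maximal_const p r = (if p \<le> r then maximal_const p else
     enn_powr (maximal_const r * enn_powr (maximal_const ((p / r) / (p / r - 1))) (1 - 1 / (p / r))) (p / r))"

lemma vector_maximal_const_bounds:
  assumes "1 < p" "1 < r"
  shows "vector_maximal_const p r \<noteq> 0" "vector_maximal_const p r \<noteq> top"
proof -
  have "maximal_const ((p / r) / (p / r - 1)) \<noteq> 0" if "r < p"
    using assms that by (intro maximal_const_pos) (simp add: field_simps)
  moreover have "maximal_const q \<noteq> top" for q by (simp add: maximal_const_def)
  ultimately show "vector_maximal_const p r \<noteq> 0" "vector_maximal_const p r \<noteq> top"
    using assms by (auto simp: vector_maximal_const_def maximal_const_pos ennreal_mult_eq_top_iff)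
qed

lemma (in laminar_family) vector_maximal_bound:
  assumes "finite J" "\<And>j. j \<in> J \<Longrightarrow> f j \<in> borel_measurable M"
    and "\<And>j x. j \<in> J \<Longrightarrow> f j x \<noteq> top" and "1 < p" "1 < r"
  shows "(\<integral>\<^sup>+x. enn_powr (lr_norm r J (\<lambda>j. maximal (f j) x)) p \<partial>M)
           \<le> vector_maximal_const p r * (\<integral>\<^sup>+x. enn_powr (lr_norm r J (\<lambda>j. f j x)) p \<partial>M)"
  using vector_maximal_bound_le[OF assms(1-3), where p = p and r = r]
    vector_maximal_bound_ge[OF assms(1,2), where p = p and r = r and q = "p / r"] assms(4,5)
  by (simp add: vector_maximal_const_def)

section \<open>Vector-valued bounds for sparse operators\<close>

definition sparse_operator :: "'a measure \<Rightarrow> 'a set set \<Rightarrow> ('a \<Rightarrow> ennreal) \<Rightarrow> 'a \<Rightarrow> ennreal" where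
  "sparse_operator M \<Q> f x = (\<Sum>Q\<in>\<Q>. average M Q f * indicator Q x)"

definition sparse_const :: "real \<Rightarrow> real \<Rightarrow> ennreal" where
  "sparse_const p r = 2 * (enn_powr (vector_maximal_const p r) (1 / p)
     * enn_powr (vector_maximal_const (p / (p - 1)) (r / (r - 1))) (1 - 1 / p))"

lemma sparse_const_bounds:
  assumes "1 < p" "1 < r"
  shows "sparse_const p r \<noteq> 0" "sparse_const p r \<noteq> top"
  using vector_maximal_const_bounds[of p r] vector_maximal_const_bounds[of "p / (p - 1)" "r / (r - 1)"] assms
  by (auto simp: sparse_const_def field_simps ennreal_mult_eq_top_iff)

context laminar_family
begin

text \<open>
  The measure of \<open>Q\<close> is at most twice that of the large part \<open>D j Q\<close>, on which both averages are below
  the maximal functions. The large parts are disjoint for fixed \<open>j\<close>, so the sum over \<open>Q\<close> is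
  absorbed by a single integral, whatever the number of overlapping cubes.
\<close>

lemma sparse_form_le_maximal:
  assumes J: "finite J" and \<Q>: "\<And>j. j \<in> J \<Longrightarrow> \<Q> j \<subseteq> F"
    and [measurable]: "\<And>j Q. j \<in> J \<Longrightarrow> Q \<in> \<Q> j \<Longrightarrow> D j Q \<in> sets M"
    and D_sub: "\<And>j Q. j \<in> J \<Longrightarrow> Q \<in> \<Q> j \<Longrightarrow> D j Q \<subseteq> Q"
    and D_large: "\<And>j Q. j \<in> J \<Longrightarrow> Q \<in> \<Q> j \<Longrightarrow> emeasure M Q \<le> 2 * emeasure M (D j Q)"
    and D_disj: "\<And>j. j \<in> J \<Longrightarrow> disjoint_family_on (D j) (\<Q> j)"
  shows "(\<Sum>j\<in>J. \<Sum>Q\<in>\<Q> j. average M Q (f j) * (\<integral>\<^sup>+x\<in>Q. g j x \<partial>M))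
           \<le> 2 * (\<integral>\<^sup>+x. (\<Sum>j\<in>J. maximal (f j) x * maximal (g j) x) \<partial>M)"
proof -
  have "(\<Sum>Q\<in>\<Q> j. average M Q (f j) * (\<integral>\<^sup>+x\<in>Q. g j x \<partial>M))
      \<le> 2 * (\<integral>\<^sup>+x. maximal (f j) x * maximal (g j) x \<partial>M)" if j: "j \<in> J" for j
  proof -
    let ?h = "\<lambda>x. maximal (f j) x * maximal (g j) x"
    have fin: "finite (\<Q> j)" using \<Q>[OF j] finite_F by (rule finite_subset)
    have "(\<Sum>Q\<in>\<Q> j. average M Q (f j) * (\<integral>\<^sup>+x\<in>Q. g j x \<partial>M)) \<le> (\<Sum>Q\<in>\<Q> j. 2 * (\<integral>\<^sup>+x\<in>D j Q. ?h x \<partial>M))"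
    proof (rule sum_mono)
      fix Q assume Q: "Q \<in> \<Q> j"
      then have QF: "Q \<in> F" using \<Q>[OF j] by auto
      let ?c = "average M Q (f j) * average M Q (g j)"
      have "average M Q (f j) * (\<integral>\<^sup>+x\<in>Q. g j x \<partial>M) = ?c * emeasure M Q"
        by (simp add: average_times_emeasure[OF QF, symmetric] mult.assoc)
      also have "\<dots> \<le> ?c * (2 * emeasure M (D j Q))"
        by (intro mult_left_mono D_large j Q) auto
      also have "\<dots> = 2 * (\<integral>\<^sup>+x\<in>D j Q. ?c \<partial>M)"
        by (subst nn_integral_cmult_indicator) (use j Q in \<open>auto simp: mult_ac\<close>)
      also have "\<dots> \<le> 2 * (\<integral>\<^sup>+x\<in>D j Q. ?h x \<partial>M)"
        using D_sub[OF j Q] QF by (intro mult_left_mono nn_integral_mono)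
          (auto split: split_indicator intro!: mult_mono average_le_maximal)
      finally show "average M Q (f j) * (\<integral>\<^sup>+x\<in>Q. g j x \<partial>M) \<le> 2 * (\<integral>\<^sup>+x\<in>D j Q. ?h x \<partial>M)" .
    qed
    also have "\<dots> = 2 * (\<integral>\<^sup>+x. (\<Sum>Q\<in>\<Q> j. ?h x * indicator (D j Q) x) \<partial>M)"
      using j by (simp add: sum_distrib_left nn_integral_sum)
    also have "\<dots> \<le> 2 * (\<integral>\<^sup>+x. ?h x \<partial>M)"
    proof (intro mult_left_mono nn_integral_mono)
      fix x
      have "(\<Sum>Q\<in>\<Q> j. indicator (D j Q) x) = (indicator (\<Union>(D j ` \<Q> j)) x :: ennreal)"
        by (rule indicator_UN_disjoint[OF fin D_disj[OF j], symmetric])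
      then show "(\<Sum>Q\<in>\<Q> j. ?h x * indicator (D j Q) x) \<le> ?h x"
        by (simp add: sum_distrib_left[symmetric] split: split_indicator)
    qed auto
    finally show ?thesis .
  qed
  then have "(\<Sum>j\<in>J. \<Sum>Q\<in>\<Q> j. average M Q (f j) * (\<integral>\<^sup>+x\<in>Q. g j x \<partial>M))
      \<le> (\<Sum>j\<in>J. 2 * (\<integral>\<^sup>+x. maximal (f j) x * maximal (g j) x \<partial>M))" by (rule sum_mono)
  then show ?thesis by (simp add: nn_integral_sum sum_distrib_left)
qed

text \<open>
  Duality: with \<open>U\<close> the \<open>\<ell>\<^sup>r\<close> norm of the output \<open>H\<^sub>j = \<theta>\<^sub>j U\<close>, the sequence
  \<open>g\<^sub>j = \<theta>\<^sub>j\<^bsup>r-1\<^esup> U\<^bsup>p-1\<^esup>\<close> satisfies \<open>\<Sum>\<^sub>j H\<^sub>j g\<^sub>j = U\<^sup>p\<close>, and its pointwise norm for the exponent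
  conjugate to \<open>r\<close> is \<open>U\<^bsup>p-1\<^esup>\<close>. The bilinear form is bounded by maximal functions of
  \<open>f\<close> and \<open>g\<close>, and the vector-valued maximal inequality applies to both, with the exponents \<open>p, r\<close> and with their conjugates.
\<close>

theorem sparse_vector_bound:
  assumes J: "finite J" and \<Q>: "\<And>j. j \<in> J \<Longrightarrow> \<Q> j \<subseteq> F"
    and D: "\<And>j Q. j \<in> J \<Longrightarrow> Q \<in> \<Q> j \<Longrightarrow> D j Q \<in> sets M"
     "\<And>j Q. j \<in> J \<Longrightarrow> Q \<in> \<Q> j \<Longrightarrow> D j Q \<subseteq> Q"
     "\<And>j Q. j \<in> J \<Longrightarrow> Q \<in> \<Q> j \<Longrightarrow> emeasure M Q \<le> 2 * emeasure M (D j Q)"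
     "\<And>j. j \<in> J \<Longrightarrow> disjoint_family_on (D j) (\<Q> j)"
    and [measurable]: "\<And>j. j \<in> J \<Longrightarrow> f j \<in> borel_measurable M"
    and f_fin: "\<And>j x. j \<in> J \<Longrightarrow> f j x \<noteq> top" and p: "1 < p" and r: "1 < r"
  shows "(\<integral>\<^sup>+x. enn_powr (lr_norm r J (\<lambda>j. sparse_operator M (\<Q> j) (f j) x)) p \<partial>M)
           \<le> enn_powr (sparse_const p r) p * (\<integral>\<^sup>+x. enn_powr (lr_norm r J (\<lambda>j. f j x)) p \<partial>M)"
    (is "?L \<le> _ * ?R")
proof (cases "?R = top")
  case True
  then show ?thesis using sparse_const_bounds[OF p r] by (simp add: ennreal_mult_top)
next
  case False
  define H where "H j x = sparse_operator M (\<Q> j) (f j) x" for j x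
  define U where "U x = lr_norm r J (\<lambda>j. H j x)" for x
  define \<theta> where "\<theta> j x = H j x / U x" for j x
  \<comment> \<open>The extremal sequence \<open>H\<^sub>j\<^bsup>r-1\<^esup> U\<^bsup>p-r\<^esup>\<close>, written so that both exponents are positive also for \<open>p < r\<close>.\<close>
  define g where "g j x = enn_powr (\<theta> j x) (r - 1) * enn_powr (U x) (p - 1)" for j x
  define p' where "p' = p / (p - 1)"
  define r' where "r' = r / (r - 1)"
  have p': "1 < p'" "1 / p' = 1 - 1 / p" "(p - 1) * p' = p" using p by (auto simp: p'_def field_simps)
  have r': "1 < r'" "1 / r + 1 / r' = 1" "(r - 1) * r' = r" using r by (auto simp: r'_def field_simps)
  have \<Q>_fin: "finite (\<Q> j)" if "j \<in> J" for j using \<Q>[OF that] finite_F by (rule finite_subset)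
  have \<Q>_sets[measurable]: "Q \<in> sets M" if "Q \<in> \<Q> j" "j \<in> J" for j Q
    using \<Q>[OF that(2)] that(1) by (intro sets_F) auto
  have [measurable]: "H j \<in> borel_measurable M" if "j \<in> J" for j
    using that unfolding H_def[abs_def] sparse_operator_def by measurable
  have [measurable]: "U \<in> borel_measurable M" unfolding U_def[abs_def] by measurable
  have [measurable]: "g j \<in> borel_measurable M" if "j \<in> J" for j
    using that unfolding g_def[abs_def] \<theta>_def by measurable
  have average_fin: "average M Q (f j) \<noteq> top" if j: "j \<in> J" and Q: "Q \<in> F" for j Q
  proof (rule average_finite)
    have "(\<integral>\<^sup>+x. enn_powr (f j x) p \<partial>M) \<le> ?R"
      using le_lr_norm[OF J j, of r] r p by (intro nn_integral_mono enn_powr_mono) auto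
    then show "(\<integral>\<^sup>+x. enn_powr (f j x) p \<partial>M) \<noteq> top" using False by (auto simp: top_unique)
  qed (use p j Q in auto)
  have H_fin: "H j x \<noteq> top" if j: "j \<in> J" for j x
    using average_fin[OF j] \<Q>[OF j] \<Q>_fin[OF j]
    by (auto simp: H_def sparse_operator_def ennreal_mult_eq_top_iff split: split_indicator)
  have U_fin: "U x \<noteq> top" for x unfolding U_def using J H_fin by (rule lr_norm_finite)
  have H_eq: "H j x = \<theta> j x * U x" if "j \<in> J" for j x
    unfolding \<theta>_def U_def using lr_direction[OF J that, of r "\<lambda>j. H j x"] r U_fin[of x, unfolded U_def] by simp
  have \<theta>_sum: "(\<Sum>j\<in>J. enn_powr (\<theta> j x) r * enn_powr (U x) s) = enn_powr (U x) s" for s x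
    using lr_direction_norm_times[of r J "\<lambda>j. H j x" s] r U_fin[of x, unfolded U_def]
    by (simp add: \<theta>_def U_def)
  have g_fin: "g j x \<noteq> top" if j: "j \<in> J" for j x
  proof -
    have "H j x \<le> U x" unfolding U_def using le_lr_norm[OF J j, of r "\<lambda>j. H j x"] r by simp
    then have "\<theta> j x \<noteq> top" using H_fin[OF j, of x] by (auto simp: \<theta>_def ennreal_divide_eq_top_iff)
    then show ?thesis using U_fin by (simp add: g_def ennreal_mult_eq_top_iff)
  qed
  have g_norm: "lr_norm r' J (\<lambda>j. g j x) = enn_powr (U x) (p - 1)" for x
  proof -
    have "(\<Sum>j\<in>J. enn_powr (g j x) r') = enn_powr (U x) ((p - 1) * r')"
      using \<theta>_sum[of x "(p - 1) * r'"] r' by (simp add: g_def enn_powr_mult enn_powr_powr)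
    then show ?thesis using r' by (simp add: lr_norm_def enn_powr_powr)
  qed
  have U_powr: "enn_powr (U x) p = (\<Sum>j\<in>J. H j x * g j x)" for x
  proof -
    have "H j x * g j x = enn_powr (\<theta> j x) r * enn_powr (U x) p" if "j \<in> J" for j
      using enn_powr_add[of "\<theta> j x" 1 "r - 1"] enn_powr_add[of "U x" 1 "p - 1"] H_eq[OF that]
      by (simp add: g_def mult_ac)
    then show ?thesis using \<theta>_sum[of x p] by simp
  qed
  have L: "?L = (\<integral>\<^sup>+x. enn_powr (U x) p \<partial>M)" by (simp add: U_def H_def)
  have L_fin: "?L \<noteq> top"
  proof (rule bounded_on_F_integral_finite)
    let ?c = "lr_norm r J (\<lambda>j. \<Sum>Q\<in>\<Q> j. average M Q (f j))"
    show "?c \<noteq> top"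
      using average_fin \<Q> \<Q>_fin by (intro lr_norm_finite J) (auto simp: subset_iff)
    show "lr_norm r J (\<lambda>j. sparse_operator M (\<Q> j) (f j) x) \<le> ?c * indicator (\<Union>F) x" for x
    proof (cases "x \<in> \<Union>F")
      case True
      then show ?thesis
        using r by (auto simp: sparse_operator_def intro!: lr_norm_mono sum_mono split: split_indicator)
    next
      case False
      then have "sparse_operator M (\<Q> j) (f j) x = 0" if "j \<in> J" for j
        using \<Q>[OF that] \<Q>_fin[OF that] by (auto simp: sparse_operator_def)
      then show ?thesis by (simp add: lr_norm_def)
    qed
  qed (use p in auto)
  have "?L = (\<integral>\<^sup>+x. (\<Sum>j\<in>J. \<Sum>Q\<in>\<Q> j. average M Q (f j) * (g j x * indicator Q x)) \<partial>M)"
    unfolding L U_powr by (simp add: H_def sparse_operator_def sum_distrib_right mult.assoc mult.commute[of "indicator _ _"])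
  also have "\<dots> = (\<Sum>j\<in>J. \<Sum>Q\<in>\<Q> j. average M Q (f j) * (\<integral>\<^sup>+x\<in>Q. g j x \<partial>M))"
    by (simp add: nn_integral_sum nn_integral_cmult)
  also have "\<dots> \<le> 2 * (\<integral>\<^sup>+x. (\<Sum>j\<in>J. maximal (f j) x * maximal (g j) x) \<partial>M)"
    by (rule sparse_form_le_maximal[OF J \<Q> D])
  also have "\<dots> \<le> 2 * (\<integral>\<^sup>+x. enn_powr (enn_powr (lr_norm r J (\<lambda>j. maximal (f j) x)) p) (1 / p)
                          * enn_powr (enn_powr (lr_norm r' J (\<lambda>j. maximal (g j) x)) p') (1 / p') \<partial>M)"
    using p p'(1) by (intro mult_left_mono nn_integral_mono) (auto simp: enn_powr_powr intro!: lr_Hoelder J r r')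
  also have "\<dots> \<le> 2 * (enn_powr (\<integral>\<^sup>+x. enn_powr (lr_norm r J (\<lambda>j. maximal (f j) x)) p \<partial>M) (1 / p)
                 * enn_powr (\<integral>\<^sup>+x. enn_powr (lr_norm r' J (\<lambda>j. maximal (g j) x)) p' \<partial>M) (1 / p'))"
    using p p' by (intro mult_left_mono nn_integral_Hoelder) auto
  also have "\<dots> \<le> 2 * (enn_powr (vector_maximal_const p r * ?R) (1 / p)
      * enn_powr (vector_maximal_const p' r' * (\<integral>\<^sup>+x. enn_powr (lr_norm r' J (\<lambda>j. g j x)) p' \<partial>M)) (1 / p'))"
    using p p' r r' by (intro mult_left_mono mult_mono enn_powr_mono vector_maximal_bound J f_fin g_fin) auto
  also have "(\<integral>\<^sup>+x. enn_powr (lr_norm r' J (\<lambda>j. g j x)) p' \<partial>M) = ?L"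
    unfolding L g_norm enn_powr_powr p'(3) ..
  finally have "?L \<le> (sparse_const p r * enn_powr ?R (1 / p)) * enn_powr ?L (1 - 1 / p)"
    by (simp add: sparse_const_def enn_powr_mult mult_ac p'(2) flip: p'_def r'_def)
  then have "?L \<le> enn_powr (sparse_const p r * enn_powr ?R (1 / p)) (1 / (1 / p))"
    by (rule enn_powr_absorb) (use L_fin p in auto)
  also have "\<dots> = enn_powr (sparse_const p r) p * ?R"
    using p by (simp add: enn_powr_mult enn_powr_powr)
  finally show ?thesis .
qed

end

section \<open>Dyadic systems and sparse collections\<close>

text \<open>
  The cubes of side \<open>2\<^bsup>-k\<^esup>\<close> are the fibres of this map, with the translation vector \<open>m\<close> as the value.
\<close>

definition dyadic_index :: "real ^ 'n::finite \<Rightarrow> int \<Rightarrow> real ^ 'n \<Rightarrow> 'n \<Rightarrow> int" where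
  "dyadic_index u k y i = \<lfloor>2 powi k * y $ i - (- 1) powi k * u $ i\<rfloor>"

lemma dyadic_system_eq_index_fibres:
  "dyadic_system u = {{y. dyadic_index u k y = m} | k m. True}"
proof -
  have "(\<lambda>x. (2 powi (- k)) *\<^sub>R (x + (\<chi> i. of_int (m i)) + ((- 1) powi k) *\<^sub>R u)) ` unit_cube
      = {y. dyadic_index u k y = m}" (is "?f ` _ = _") for k and m :: "'a \<Rightarrow> int"
  proof (intro equalityI subsetI)
    fix y assume "y \<in> ?f ` unit_cube"
    then obtain x where x: "x \<in> unit_cube" "y = ?f x" by auto
    have "2 powi k * y $ i - (- 1) powi k * u $ i = x $ i + of_int (m i)" for i
      by (simp add: x(2) power_int_minus flip: mult.assoc)
    then show "y \<in> {y. dyadic_index u k y = m}"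
      using x(1) by (auto simp: dyadic_index_def unit_cube_def floor_eq_iff fun_eq_iff)
  next
    fix y assume y: "y \<in> {y. dyadic_index u k y = m}"
    let ?x = "(2 powi k) *\<^sub>R y - (\<chi> i. of_int (m i)) - ((- 1) powi k) *\<^sub>R u"
    have "\<lfloor>2 powi k * y $ i - (- 1) powi k * u $ i\<rfloor> = m i" for i
      using y by (auto simp: dyadic_index_def fun_eq_iff)
    then have "?x \<in> unit_cube"
      by (simp add: unit_cube_def floor_eq_iff) (smt (verit))
    moreover have "y = ?f ?x"
      by (simp add: power_int_minus)
    ultimately show "y \<in> ?f ` unit_cube" by blast
  qed
  then show ?thesis by (simp add: dyadic_system_def)
qed

text \<open>
  The index at level \<open>k\<close> is a function of the index at level \<open>k + 1\<close>. The alternating sign of the shift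
  is essential: the two levels differ by \<open>3 u\<^sub>i\<close> up to sign, an integer because \<open>u\<^sub>i\<close> is \<open>0\<close> or \<open>1/3\<close>.
\<close>

lemma dyadic_index_coarsen_step:
  assumes u: "u \<in> shift_params" and eq: "dyadic_index u (k + 1) y = dyadic_index u (k + 1) z"
  shows "dyadic_index u k y = dyadic_index u k z"
proof
  fix i
  have "u $ i = 0 \<or> u $ i = 1/3" using u by (auto simp: shift_params_def)
  moreover have s: "(- 1 :: real) powi k = 1 \<or> (- 1 :: real) powi k = - 1"
    by (cases "even k") (simp_all add: power_int_minus_one_minus power_int_minus_left)
  ultimately have "(- 1) powi k * u $ i \<in> {0, 1/3, - (1/3)}" by auto
  then have "3 * ((- 1) powi k * u $ i) \<in> {of_int 0, of_int 1, of_int (- 1)}" by auto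
  then obtain c :: int where c: "3 * ((- 1) powi k * u $ i) = of_int c" by blast
  have idx: "dyadic_index u (k + 1) v i = \<lfloor>2 * (2 powi k * v $ i - (- 1) powi k * u $ i)\<rfloor> + c" for v :: "real ^ 'a"
  proof -
    have "2 powi (k + 1) * v $ i - (- 1) powi (k + 1) * u $ i
        = 2 * (2 powi k * v $ i - (- 1) powi k * u $ i) + of_int c"
      by (simp add: power_int_add flip: c)
    then show ?thesis by (simp add: dyadic_index_def)
  qed
  have half: "\<lfloor>v\<rfloor> = \<lfloor>2 * v\<rfloor> div 2" for v :: real
    using floor_divide_real_eq_div[of 2 "2 * v"] by simp
  have "\<lfloor>2 * (2 powi k * y $ i - (- 1) powi k * u $ i)\<rfloor> = \<lfloor>2 * (2 powi k * z $ i - (- 1) powi k * u $ i)\<rfloor>"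
    using fun_cong[OF eq, of i] by (simp add: idx)
  then show "dyadic_index u k y i = dyadic_index u k z i"
    by (metis dyadic_index_def half)
qed

lemma dyadic_index_coarsen:
  assumes u: "u \<in> shift_params" and "k \<le> l" and "dyadic_index u l y = dyadic_index u l z"
  shows "dyadic_index u k y = dyadic_index u k z"
  using assms(2,3)
  by (induction l rule: int_ge_induct) (auto dest: dyadic_index_coarsen_step[OF u])

lemma dyadic_system_laminar:
  assumes u: "u \<in> shift_params" and PQ: "P \<in> dyadic_system u" "Q \<in> dyadic_system u"
  shows "P \<inter> Q = {} \<or> P \<subseteq> Q \<or> Q \<subseteq> P"
proof -
  obtain k m l m' where P: "P = {y. dyadic_index u k y = m}" and Q: "Q = {y. dyadic_index u l y = m'}"
    using PQ by (auto simp: dyadic_system_eq_index_fibres)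
  show ?thesis
  proof (cases "P \<inter> Q = {}")
    case False
    then obtain z where z: "z \<in> P" "z \<in> Q" by auto
    show ?thesis
    proof (cases "k \<le> l")
      case True
      then have "Q \<subseteq> P" using z P Q by (auto dest: dyadic_index_coarsen[OF u, of k l _ z])
      then show ?thesis by simp
    next
      case False
      then have "l \<le> k" by simp
      then have "P \<subseteq> Q" using z P Q by (auto dest: dyadic_index_coarsen[OF u, of l k _ z])
      then show ?thesis by simp
    qed
  qed simp
qed

lemma countable_dyadic_system: "countable (dyadic_system u)"
proof -
  have "dyadic_system u = (\<lambda>(k, m). {y. dyadic_index u k y = m}) ` UNIV"
    by (auto simp: dyadic_system_eq_index_fibres)
  then show ?thesis by (metis countableI_type countable_image)
qed

lemma dyadic_cube_measure:
  assumes "Q \<in> dyadic_system u"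
  shows "Q \<in> sets lebesgue" "emeasure lebesgue Q \<noteq> 0" "emeasure lebesgue Q \<noteq> top"
proof -
  obtain k m where "Q = {y. dyadic_index u k y = m}"
    using assms by (auto simp: dyadic_system_eq_index_fibres)
  then have Q: "Q = {y. \<forall>i. of_int (m i) \<le> 2 powi k * y $ i - (- 1) powi k * u $ i \<and>
      2 powi k * y $ i - (- 1) powi k * u $ i < of_int (m i) + 1}"
    by (auto simp: dyadic_index_def fun_eq_iff floor_eq_iff)
  define a where "a = (\<chi> i. (of_int (m i) + (- 1) powi k * u $ i) / 2 powi k)"
  define b where "b = (\<chi> i. (of_int (m i) + 1 + (- 1) powi k * u $ i) / 2 powi k)"
  have Q': "Q = {y. \<forall>i. a $ i \<le> y $ i \<and> y $ i < b $ i}"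
    unfolding Q a_def b_def by (auto simp: field_simps)
  have "{y \<in> space borel. \<forall>i. a $ i \<le> y $ i \<and> y $ i < b $ i} \<in> sets borel"
    by measurable
  then show meas: "Q \<in> sets lebesgue" by (simp add: Q' sets_completionI_sets)
  have "box a b \<subseteq> Q" "Q \<subseteq> cbox a b"
    by (auto simp: Q' mem_box_cart less_imp_le)
  have "a $ i < b $ i" for i by (simp add: a_def b_def divide_strict_right_mono)
  then have "box a b \<noteq> {}" by (simp add: interval_ne_empty_cart)
  then have "\<not> negligible Q"
    using open_not_negligible[OF open_box] negligible_subset[OF _ \<open>box a b \<subseteq> Q\<close>] by blast
  then show "emeasure lebesgue Q \<noteq> 0"
    using meas by (auto simp: negligible_iff_null_sets null_sets_def)
  have "Q \<in> lmeasurable"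
    using meas \<open>Q \<subseteq> cbox a b\<close> by (intro bounded_set_imp_lmeasurable) (auto intro: bounded_subset[OF bounded_cbox])
  then show "emeasure lebesgue Q \<noteq> top" by (auto simp: fmeasurable_def)
qed

lemma sigma_finite_lebesgue: "sigma_finite_measure (lebesgue :: 'a::euclidean_space measure)"
proof
  show "\<exists>A::'a set set. countable A \<and> A \<subseteq> sets lebesgue \<and> \<Union>A = space lebesgue \<and> (\<forall>a\<in>A. emeasure lebesgue a \<noteq> \<infinity>)"
  proof (intro exI[of _ "range (\<lambda>n::nat. cball 0 (real n))"] conjI ballI)
    show "\<Union>(range (\<lambda>n::nat. cball (0::'a) (real n))) = space lebesgue"
      by (auto simp: real_arch_simple)
    show "emeasure lebesgue a \<noteq> \<infinity>" if a: "a \<in> range (\<lambda>n::nat. cball (0::'a) (real n))" for a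
    proof -
      obtain n :: nat where "a = cball 0 (real n)" using a by auto
      then show ?thesis using fmeasurableD2[OF lmeasurable_cball[of "0 :: 'a" "real n"]] by simp
    qed
  qed auto
qed

lemma finite_dyadic_laminar_family:
  assumes "u \<in> shift_params" "finite F" "F \<subseteq> dyadic_system u"
  shows "laminar_family lebesgue F"
proof -
  interpret sigma_finite_measure "lebesgue :: (real ^ 'a) measure" by (rule sigma_finite_lebesgue)
  have sub: "Q \<in> dyadic_system u" if "Q \<in> F" for Q using that assms(3) by blast
  show ?thesis
  proof
    show "P \<inter> Q = {} \<or> P \<subseteq> Q \<or> Q \<subseteq> P" if "P \<in> F" "Q \<in> F" for P Q
      using dyadic_system_laminar[OF assms(1)] that assms(3) by blast
  qed (fact assms(2) dyadic_cube_measure[OF sub])+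
qed

lemma sparse_kernel_properties:
  assumes u: "u \<in> shift_params" and s: "sparse u \<Q>"
  shows "Q \<in> \<Q> \<Longrightarrow> sparse_kernel \<Q> Q \<in> sets lebesgue" "sparse_kernel \<Q> Q \<subseteq> Q"
    "Q \<in> \<Q> \<Longrightarrow> emeasure lebesgue Q \<le> 2 * emeasure lebesgue (sparse_kernel \<Q> Q)"
    "disjoint_family_on (sparse_kernel \<Q>) \<Q>"
proof -
  have sub: "\<Q> \<subseteq> dyadic_system u" using s by (simp add: sparse_def)
  show K_sub: "sparse_kernel \<Q> Q \<subseteq> Q" for Q by (auto simp: sparse_kernel_def)
  show meas: "sparse_kernel \<Q> Q \<in> sets lebesgue" if "Q \<in> \<Q>" for Q
  proof -
    have "countable {Q' \<in> \<Q>. Q' \<subset> Q}"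
      by (rule countable_subset[OF _ countable_dyadic_system[of u]]) (use sub in auto)
    then have "\<Union>{Q' \<in> \<Q>. Q' \<subset> Q} \<in> sets lebesgue"
      using sub by (intro sets.countable_Union) (auto intro: dyadic_cube_measure(1)[of _ u])
    then show ?thesis
      unfolding sparse_kernel_def using sub that by (intro sets.Diff) (auto intro: dyadic_cube_measure(1)[of _ u])
  qed
  show "emeasure lebesgue Q \<le> 2 * emeasure lebesgue (sparse_kernel \<Q> Q)" if Q: "Q \<in> \<Q>" for Q
  proof -
    have fin: "emeasure lebesgue Q \<noteq> top" "Q \<in> sets lebesgue"
      using sub Q dyadic_cube_measure[of Q u] by auto
    then have "emeasure lebesgue (sparse_kernel \<Q> Q) \<noteq> top"
      using emeasure_mono[OF K_sub[of Q] fin(2)] by (auto simp: top_unique)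
    moreover have "measure lebesgue Q \<le> 2 * measure lebesgue (sparse_kernel \<Q> Q)"
      using s Q by (auto simp: sparse_def)
    ultimately show ?thesis
      using fin(1) by (simp add: emeasure_eq_ennreal_measure ennreal_mult'[symmetric] flip: ennreal_numeral)
  qed
  show "disjoint_family_on (sparse_kernel \<Q>) \<Q>"
    unfolding disjoint_family_on_def
  proof (intro ballI impI)
    fix P Q assume PQ: "P \<in> \<Q>" "Q \<in> \<Q>" "P \<noteq> Q"
    then consider "P \<inter> Q = {}" | "P \<subset> Q" | "Q \<subset> P"
      using dyadic_system_laminar[OF u, of P Q] sub by auto
    then show "sparse_kernel \<Q> P \<inter> sparse_kernel \<Q> Q = {}"
      using PQ by cases (auto simp: sparse_kernel_def)
  qed
qed

section \<open>Positive Haar shifts\<close>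

lemma norm_cube_average_le:
  assumes "Q \<in> dyadic_system u"
  shows "ennreal (norm (cube_average Q f)) \<le> average lebesgue Q (\<lambda>x. ennreal (norm (f x)))"
proof -
  have m: "emeasure lebesgue Q = ennreal (measure lebesgue Q)" "0 < measure lebesgue Q"
    using dyadic_cube_measure[OF assms]
    by (auto simp: emeasure_eq_ennreal_measure zero_less_measure_iff)
  have "ennreal (norm (LINT x:Q|lebesgue. f x)) \<le> (\<integral>\<^sup>+x\<in>Q. ennreal (norm (f x)) \<partial>lebesgue)"
  proof (cases "integrable lebesgue (\<lambda>x. indicator Q x *\<^sub>R f x)")
    case True
    have "ennreal (norm (LINT x:Q|lebesgue. f x)) \<le> (\<integral>\<^sup>+x. ennreal (norm (indicator Q x *\<^sub>R f x)) \<partial>lebesgue)"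
      unfolding set_lebesgue_integral_def using True by (rule integral_norm_bound_ennreal)
    also have "\<dots> = (\<integral>\<^sup>+x\<in>Q. ennreal (norm (f x)) \<partial>lebesgue)"
      by (intro nn_integral_cong) (auto split: split_indicator)
    finally show ?thesis .
  next
    case False
    then show ?thesis by (simp add: set_lebesgue_integral_def not_integrable_integral_eq)
  qed
  then have "ennreal (norm (LINT x:Q|lebesgue. f x)) / ennreal (measure lebesgue Q)
      \<le> average lebesgue Q (\<lambda>x. ennreal (norm (f x)))"
    unfolding average_def m(1) by (rule divide_right_mono_ennreal)
  then show ?thesis
    using m(2) by (simp add: cube_average_def divide_ennreal)
qed

text \<open>
  An increasing exhaustion of a countable set by finite subsets.
\<close>

definition truncate_family :: "nat \<Rightarrow> 'a set \<Rightarrow> 'a set" where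
  "truncate_family N A = {a \<in> A. to_nat_on A a < N}"

lemma truncate_family_subset: "truncate_family N A \<subseteq> A"
  by (auto simp: truncate_family_def)

lemma truncate_family_mono: "N \<le> N' \<Longrightarrow> truncate_family N A \<subseteq> truncate_family N' A"
  by (auto simp: truncate_family_def)

lemma finite_truncate_family:
  assumes "countable A"
  shows "finite (truncate_family N A)"
proof (rule inj_on_finite)
  show "inj_on (to_nat_on A) (truncate_family N A)"
    using inj_on_to_nat_on[OF assms] truncate_family_subset by (rule inj_on_subset)
  show "to_nat_on A ` truncate_family N A \<subseteq> {..<N}" by (auto simp: truncate_family_def)
qed simp

lemma finite_subset_truncate_family:
  assumes "finite S" "S \<subseteq> A"
  obtains N where "S \<subseteq> truncate_family N A"
proof
  show "S \<subseteq> truncate_family (Suc (Max (to_nat_on A ` S))) A"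
    using assms by (auto simp: truncate_family_def less_Suc_eq_le)
qed

text \<open>
  Discards cancellation and enlarges \<open>E Q\<close> to \<open>Q\<close>; this is where the dependence on \<open>\<kappa>\<close> disappears.
  Where the defining series fails to converge, its value \<open>0\<close> satisfies the bound trivially.
\<close>

lemma norm_scalar_shift_le:
  assumes \<Q>: "\<Q> \<subseteq> dyadic_system u" and E: "\<And>Q. Q \<in> \<Q> \<Longrightarrow> E Q \<subseteq> Q"
  shows "ennreal (norm (scalar_shift \<Q> E f x))
           \<le> (SUP N. sparse_operator lebesgue (truncate_family N \<Q>) (\<lambda>x. ennreal (norm (f x))) x)"
    (is "_ \<le> ?S")
proof -
  have ctb: "countable \<Q>" using \<Q> countable_dyadic_system by (rule countable_subset)
  let ?t = "\<lambda>Q. indicator (E Q) x *\<^sub>R cube_average Q f"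
  have part: "ennreal (norm (sum ?t S)) \<le> ?S" if S: "finite S" "S \<subseteq> \<Q>" for S
  proof -
    obtain N where N: "S \<subseteq> truncate_family N \<Q>" using finite_subset_truncate_family[OF S] .
    have "ennreal (norm (sum ?t S)) \<le> ennreal (\<Sum>Q\<in>S. norm (?t Q))"
      by (intro ennreal_leI norm_sum)
    also have "\<dots> = (\<Sum>Q\<in>S. ennreal (norm (?t Q)))" by simp
    also have "\<dots> \<le> (\<Sum>Q\<in>S. average lebesgue Q (\<lambda>x. ennreal (norm (f x))) * indicator Q x)"
    proof (rule sum_mono)
      fix Q assume "Q \<in> S"
      then show "ennreal (norm (?t Q)) \<le> average lebesgue Q (\<lambda>x. ennreal (norm (f x))) * indicator Q x"
        using S \<Q> E[of Q] norm_cube_average_le[of Q u f] by (auto split: split_indicator)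
    qed
    also have "\<dots> \<le> sparse_operator lebesgue (truncate_family N \<Q>) (\<lambda>x. ennreal (norm (f x))) x"
      unfolding sparse_operator_def by (intro sum_mono2 N finite_truncate_family ctb) auto
    also have "\<dots> \<le> ?S" by (rule SUP_upper) simp
    finally show ?thesis .
  qed
  show ?thesis
  proof (cases "?t summable_on \<Q> \<and> ?S \<noteq> top")
    case True
    then obtain c where c: "?S = ennreal c" "0 \<le> c" by (cases ?S) auto
    have "(sum ?t \<longlongrightarrow> infsum ?t \<Q>) (finite_subsets_at_top \<Q>)"
      using True by (auto simp: has_sum_infsum simp flip: has_sum_def)
    then have "((\<lambda>S. norm (sum ?t S)) \<longlongrightarrow> norm (infsum ?t \<Q>)) (finite_subsets_at_top \<Q>)"
      by (rule tendsto_norm)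
    moreover have "\<forall>\<^sub>F S in finite_subsets_at_top \<Q>. norm (sum ?t S) \<le> c"
      using part c by (intro eventually_finite_subsets_at_top_weakI) simp
    ultimately have "norm (infsum ?t \<Q>) \<le> c"
      by (rule tendsto_upperbound) simp
    then show ?thesis by (simp add: c scalar_shift_def ennreal_leI)
  next
    case False
    then consider "?S = top" | "\<not> ?t summable_on \<Q>" by blast
    then show ?thesis
    proof cases
      case 1
      then show ?thesis by (simp only: top_greatest)
    next
      case 2
      then show ?thesis by (simp add: scalar_shift_def infsum_not_exists)
    qed
  qed
qed

text \<open>
  The same truncation level \<open>N\<close> is used for the cubes and for the indices \<open>j\<close>, so that the truncated
  norms form one increasing sequence of functions, each of which involves finitely many cubes.
\<close>

theorem vector_shift_bound:
  assumes shift: "positive_haar_shift \<kappa> \<Q> E" and p: "1 < p" and r: "1 < r"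
    and [measurable]: "\<And>j. f j \<in> borel_measurable lebesgue"
  shows "Lp_norm p (vector_shift r \<Q> E f) \<le> sparse_const p r * Lp_ellr_norm p r f"
proof -
  obtain u where u: "u \<in> shift_params" and sp: "\<And>j. sparse u (\<Q> j)"
    using shift by (auto simp: positive_haar_shift_def)
  have \<Q>: "\<Q> j \<subseteq> dyadic_system u" for j using sp by (simp add: sparse_def)
  have ctb: "countable (\<Q> j)" for j using \<Q> countable_dyadic_system by (rule countable_subset)
  have E: "E j Q \<subseteq> Q" if Q: "Q \<in> \<Q> j" for j Q
  proof -
    have "\<exists>\<C>. (\<forall>K\<in>\<C>. is_cube K \<and> K \<subseteq> Q) \<and> E j Q = \<Union>\<C>"
      using shift Q by (simp add: positive_haar_shift_def)
    then show ?thesis by auto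
  qed
  let ?f = "\<lambda>j x. ennreal (norm (f j x))"
  define T where "T j N x = sparse_operator lebesgue (truncate_family N (\<Q> j)) (?f j) x" for j N x
  define W where "W N x = enn_powr (lr_norm r {..<N} (\<lambda>j. T j N x)) p" for N x
  have fin: "finite (truncate_family N (\<Q> j))" for N j by (rule finite_truncate_family[OF ctb])
  have [measurable]: "Q \<in> sets lebesgue" if "Q \<in> truncate_family N (\<Q> j)" for Q N j
    by (rule dyadic_cube_measure(1)[OF subsetD[OF order_trans[OF truncate_family_subset \<Q>] that]])
  have [measurable]: "T j N \<in> borel_measurable lebesgue" for j N
    unfolding T_def[abs_def] sparse_operator_def by measurable
  have [measurable]: "W N \<in> borel_measurable lebesgue" for N
    unfolding W_def[abs_def] by measurable
  have T_mono: "T j N x \<le> T j N' x" if "N \<le> N'" for j N N' x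
    unfolding T_def sparse_operator_def
    by (intro sum_mono2 fin truncate_family_mono that) auto
  have sum_mono': "(\<Sum>j<n. enn_powr (T j N x) r) \<le> (\<Sum>j<N'. enn_powr (T j N' x) r)"
    if "n \<le> N'" "N \<le> N'" for n N N' x
  proof -
    have "(\<Sum>j<n. enn_powr (T j N x) r) \<le> (\<Sum>j<n. enn_powr (T j N' x) r)"
      using r that by (intro sum_mono enn_powr_mono T_mono) auto
    also have "\<dots> \<le> (\<Sum>j<N'. enn_powr (T j N' x) r)"
      using that by (intro sum_mono2) auto
    finally show ?thesis .
  qed
  have W_inc: "incseq W"
    using sum_mono' p r by (auto simp: incseq_def le_fun_def W_def lr_norm_powr intro!: enn_powr_mono)
  \<comment> \<open>Bounding pointwise by a limit of measurable functions makes monotone convergence applicable.\<close>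
  have pointwise: "enn_powr (vector_shift r \<Q> E f x) p \<le> (SUP N. W N x)" for x
  proof -
    let ?a = "\<lambda>j. ennreal (norm (scalar_shift (\<Q> j) (E j) (f j) x) powr r)"
    \<comment> \<open>One diagonal supremum replaces the two separate limits in the cubes and in \<open>j\<close>.\<close>
    let ?V = "SUP N. \<Sum>j<N. enn_powr (T j N x) r"
    have "(\<Sum>j<n. ?a j) \<le> ?V" for n
    proof -
      have "(\<Sum>j<n. ?a j) \<le> (\<Sum>j<n. SUP N. enn_powr (T j N x) r)"
      proof (rule sum_mono)
        fix j
        have "?a j = enn_powr (ennreal (norm (scalar_shift (\<Q> j) (E j) (f j) x))) r"
          by (simp add: enn_powr_ennreal)
        also have "\<dots> \<le> enn_powr (SUP N. T j N x) r"
          unfolding T_def using r by (intro enn_powr_mono norm_scalar_shift_le[OF \<Q>] E) auto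
        finally show "?a j \<le> (SUP N. enn_powr (T j N x) r)" using r by (simp add: enn_powr_SUP)
      qed
      also have "\<dots> = (SUP N. \<Sum>j<n. enn_powr (T j N x) r)"
        using r by (intro ennreal_SUP_sum[symmetric]) (auto simp: incseq_def intro!: enn_powr_mono T_mono)
      also have "\<dots> \<le> ?V"
      proof (rule SUP_least)
        show "(\<Sum>j<n. enn_powr (T j N x) r) \<le> ?V" for N
          by (rule SUP_upper2[of "max n N"]) (auto intro: sum_mono')
      qed
      finally show ?thesis .
    qed
    then have "(\<Sum>j. ?a j) \<le> ?V" by (rule suminf_le_const[OF summableI])
    then have "enn_powr (\<Sum>j. ?a j) (p / r) \<le> enn_powr ?V (p / r)"
      using p r by (intro enn_powr_mono) auto
    also have "\<dots> = (SUP N. W N x)"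
      using p r by (simp add: enn_powr_SUP W_def lr_norm_powr)
    finally show ?thesis by (simp add: vector_shift_def enn_powr_powr)
  qed
  let ?R = "\<integral>\<^sup>+x. enn_powr (\<Sum>j. ennreal (norm (f j x) powr r)) (p / r) \<partial>lebesgue"
  have W_bound: "(\<integral>\<^sup>+x. W N x \<partial>lebesgue) \<le> enn_powr (sparse_const p r) p * ?R" for N
  proof -
    interpret laminar_family lebesgue "\<Union>j<N. truncate_family N (\<Q> j)"
      by (rule finite_dyadic_laminar_family[OF u]) (auto intro: fin subsetD[OF order_trans[OF truncate_family_subset \<Q>]])
    have "(\<integral>\<^sup>+x. W N x \<partial>lebesgue) \<le> enn_powr (sparse_const p r) p
        * (\<integral>\<^sup>+x. enn_powr (lr_norm r {..<N} (\<lambda>j. ?f j x)) p \<partial>lebesgue)"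
      unfolding W_def T_def
    proof (rule sparse_vector_bound[where D = "\<lambda>j. sparse_kernel (\<Q> j)"])
      show "disjoint_family_on (sparse_kernel (\<Q> j)) (truncate_family N (\<Q> j))" for j
        using truncate_family_subset sparse_kernel_properties(4)[OF u sp] by (rule disjoint_family_on_mono)
      fix j Q assume "Q \<in> truncate_family N (\<Q> j)"
      then have Q: "Q \<in> \<Q> j" by (rule subsetD[OF truncate_family_subset])
      show "sparse_kernel (\<Q> j) Q \<in> sets lebesgue" "sparse_kernel (\<Q> j) Q \<subseteq> Q"
        "emeasure lebesgue Q \<le> 2 * emeasure lebesgue (sparse_kernel (\<Q> j) Q)"
        by (fact sparse_kernel_properties(1)[OF u sp Q] sparse_kernel_properties(2)[OF u sp]
            sparse_kernel_properties(3)[OF u sp Q])+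
    qed (use p r in auto)
    also have "\<dots> \<le> enn_powr (sparse_const p r) p * ?R"
    proof (intro mult_left_mono nn_integral_mono)
      fix x
      have "(\<Sum>j<N. enn_powr (?f j x) r) \<le> (\<Sum>j. ennreal (norm (f j x) powr r))"
        by (simp add: enn_powr_ennreal sum_le_suminf del: sum_ennreal)
      then show "enn_powr (lr_norm r {..<N} (\<lambda>j. ?f j x)) p \<le> enn_powr (\<Sum>j. ennreal (norm (f j x) powr r)) (p / r)"
        using p r by (simp add: lr_norm_powr enn_powr_mono)
    qed simp
    finally show ?thesis .
  qed
  have "(\<integral>\<^sup>+x. enn_powr (vector_shift r \<Q> E f x) p \<partial>lebesgue) \<le> (SUP N. \<integral>\<^sup>+x. W N x \<partial>lebesgue)"
    using pointwise by (subst nn_integral_monotone_convergence_SUP[OF W_inc, symmetric]) (auto intro: nn_integral_mono)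
  also have "\<dots> \<le> enn_powr (sparse_const p r) p * ?R"
    by (rule SUP_least) (rule W_bound)
  finally have "Lp_norm p (vector_shift r \<Q> E f) \<le> enn_powr (enn_powr (sparse_const p r) p * ?R) (1 / p)"
    unfolding Lp_norm_def using p by (intro enn_powr_mono) auto
  also have "\<dots> = sparse_const p r * Lp_ellr_norm p r f"
    using p by (simp add: Lp_ellr_norm_def enn_powr_mult enn_powr_powr)
  finally show ?thesis .
qed

theorem theorem1p13:
  fixes p r r' :: real
  assumes "1 < p" and "1 < r" and "r' = r / (r - 1)"
  shows "\<exists>C :: real. \<forall>\<kappa> :: nat. 1 \<le> \<kappa> \<longrightarrow>
           (\<forall>(\<Q> :: nat \<Rightarrow> (real ^ 'n::finite) set set) E.
              positive_haar_shift \<kappa> \<Q> E \<longrightarrow>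
              shift_norm p r \<Q> E \<le> ennreal (C * real \<kappa> ^ 2 * real \<kappa> powr max r r'))"
proof (intro exI[of _ "enn2real (sparse_const p r)"] allI impI)
  fix \<kappa> :: nat and \<Q> :: "nat \<Rightarrow> (real ^ 'n) set set" and E
  assume \<kappa>: "1 \<le> \<kappa>" and shift: "positive_haar_shift \<kappa> \<Q> E"
  let ?C = "enn2real (sparse_const p r)"
  have "1 \<le> real \<kappa> powr max r r'" using \<kappa> assms(2) by (intro ge_one_powr_ge_zero) auto
  then have "1 * 1 \<le> real \<kappa> ^ 2 * real \<kappa> powr max r r'"
    using \<kappa> by (intro mult_mono one_le_power) auto
  then have "?C * 1 \<le> ?C * (real \<kappa> ^ 2 * real \<kappa> powr max r r')"
    by (intro mult_left_mono) auto
  then have le: "ennreal ?C \<le> ennreal (?C * real \<kappa> ^ 2 * real \<kappa> powr max r r')"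
    by (intro ennreal_leI) (simp add: mult.assoc)
  have "ennreal ?C = sparse_const p r"
    using sparse_const_bounds(2)[OF assms(1,2)] by (simp add: less_top)
  with le have C: "sparse_const p r \<le> ennreal (?C * real \<kappa> ^ 2 * real \<kappa> powr max r r')"
    by (simp only:)
  show "shift_norm p r \<Q> E \<le> ennreal (?C * real \<kappa> ^ 2 * real \<kappa> powr max r r')"
    unfolding shift_norm_def
  proof (intro Inf_lower CollectI ballI)
    fix f :: "nat \<Rightarrow> real ^ 'n \<Rightarrow> complex" assume "f \<in> Lp_ellr p r"
    then have "Lp_norm p (vector_shift r \<Q> E f) \<le> sparse_const p r * Lp_ellr_norm p r f"
      by (intro vector_shift_bound[OF shift assms(1,2)]) (auto simp: Lp_ellr_def)
    also have "\<dots> \<le> ennreal (?C * real \<kappa> ^ 2 * real \<kappa> powr max r r') * Lp_ellr_norm p r f"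
      using C by (rule mult_right_mono) simp
    finally show "Lp_norm p (vector_shift r \<Q> E f)
        \<le> ennreal (?C * real \<kappa> ^ 2 * real \<kappa> powr max r r') * Lp_ellr_norm p r f" .
  qed
qed

end
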